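(* Let $P$ be a finite poset and let $P'=\{p_{i_1},\ldots,p_{i_r}\}$ be the subset of all elements of $P$ which are comparable to every element of $P$. Let $P''$ be the induced subposet of $P$ on the set $P\setminus P'$. Then the following are equivalent: (a) $R[\mathcal{I}(P)]$ is a complete intersection. (b) Either $P$ is a chain, or $P''$ is isomorphic, for some $n\ge 1$, to the poset $\{p_1,\ldots,p_{2n}\}$ which is the ordinal sum $\{p_1,p_2\}\oplus\{p_3,p_4\}\oplus\cdots\oplus\{p_{2n-1},p_{2n}\}$ of $n$ two-element antichains.
   Context: $K$ is a field and all posets are finite. For a poset $P=\{p_1,\ldots,p_n\}$, $\mathcal{I}(P)$ is the distributive lattice of order ideals (down-closed subsets, including $\emptyset$ and $P$) of $P$, ordered by inclusion. The Hibi ring $R[\mathcal{I}(P)]$ is the $K$-subalgebra of the polynomial ring $K[t,z_1,\ldots,z_n]$ generated by the monomials $u_\alpha=t\prod_{p_i\in\alpha}z_i$, $\alpha\in\mathcal{I}(P)$. It is the quotient of the polynomial ring $K[x_\alpha:\alpha\in\mathcal{I}(P)]$ by the Hibi ideal $I_{\mathcal{I}(P)}=(x_\alpha x_\beta-x_{\alpha\cap\beta}x_{\alpha\cup\beta}:\alpha,\beta\in\mathcal{I}(P)\text{ incomparable})$, the kernel of $x_\alpha\mapsto u_\alpha$; it is a complete intersection if this ideal is generated by a regular sequence. The ordinal sum $P_1\oplus P_2$ of disjoint posets is the poset on $P_1\cup P_2$ that keeps the orders of $P_1$ and $P_2$ and puts every element of $P_1$ below every element of $P_2$. *)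

theory Defs
  imports "HOL-Algebra.Algebra" "HOL-Library.Poly_Mapping"
begin

section \<open>Finite posets\<close>

text \<open>
  A poset is a carrier set together with the graph of its (reflexive) order relation,
  i.e. a pair \<open>(P, r)\<close> with \<^term>\<open>partial_order_on P r\<close>.
\<close>

definition poset_isomorphic :: "'a set \<times> 'a rel \<Rightarrow> 'b set \<times> 'b rel \<Rightarrow> bool" where
  "poset_isomorphic A B \<longleftrightarrow>
     (\<exists>f. bij_betw f (fst A) (fst B) \<and>
          (\<forall>x\<in>fst A. \<forall>y\<in>fst A. (x, y) \<in> snd A \<longleftrightarrow> (f x, f y) \<in> snd B))"

text \<open>Only meaningful for posets with disjoint carriers.\<close>

definition ordinal_sum :: "'a set \<times> 'a rel \<Rightarrow> 'a set \<times> 'a rel \<Rightarrow> 'a set \<times> 'a rel" where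
  "ordinal_sum A B = (fst A \<union> fst B, snd A \<union> snd B \<union> fst A \<times> fst B)"

definition antichain_poset :: "'a set \<Rightarrow> 'a set \<times> 'a rel" where
  "antichain_poset A = (A, Id_on A)"

text \<open>
  The element \<open>p\<^sub>i\<close> is the natural number \<open>i\<close>, so that the \<open>n\<close>-th poset is
  \<open>{1, 2} \<oplus> {3, 4} \<oplus> \<dots> \<oplus> {2n - 1, 2n}\<close>; the case \<open>n = 0\<close> is the empty poset.
\<close>

fun antichain_pairs_sum :: "nat \<Rightarrow> nat set \<times> nat rel" where
  "antichain_pairs_sum 0 = ({}, {})"
| "antichain_pairs_sum (Suc n) =
     ordinal_sum (antichain_pairs_sum n) (antichain_poset {2 * n + 1, 2 * n + 2})"

definition comparable_to_all :: "'a set \<Rightarrow> 'a rel \<Rightarrow> 'a set" where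
  "comparable_to_all P r = {p \<in> P. \<forall>q\<in>P. (p, q) \<in> r \<or> (q, p) \<in> r}"

definition induced_subposet :: "'a rel \<Rightarrow> 'a set \<Rightarrow> 'a set \<times> 'a rel" where
  "induced_subposet r Q = (Q, Restr r Q)"

definition order_ideals :: "'a set \<Rightarrow> 'a rel \<Rightarrow> 'a set set" where
  "order_ideals P r = {\<alpha>. \<alpha> \<subseteq> P \<and> (\<forall>x\<in>\<alpha>. \<forall>y. (y, x) \<in> r \<longrightarrow> y \<in> \<alpha>)}"


section \<open>Polynomial rings and regular sequences\<close>

text \<open>A polynomial is a finitely supported map from exponent vectors to coefficients.\<close>

type_synonym ('v, 'k) mpoly = "('v \<Rightarrow>\<^sub>0 nat) \<Rightarrow>\<^sub>0 'k"

definition mpoly_const :: "'k::comm_ring_1 \<Rightarrow> ('v, 'k) mpoly" where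
  "mpoly_const c = Poly_Mapping.single 0 c"

definition mpoly_var :: "'v \<Rightarrow> ('v, 'k::comm_ring_1) mpoly" where
  "mpoly_var v = Poly_Mapping.single (Poly_Mapping.single v 1) 1"

text \<open>The polynomial ring \<open>K[v : v \<in> V]\<close>.\<close>

definition mpoly_ring :: "'v set \<Rightarrow> ('v, 'k::comm_ring_1) mpoly ring" where
  "mpoly_ring V =
     \<lparr>carrier = {p. \<forall>m\<in>Poly_Mapping.keys p. Poly_Mapping.keys m \<subseteq> V},
      monoid.mult = (*), one = 1, ring.zero = 0, ring.add = (+)\<rparr>"

text \<open>The \<open>K\<close>-algebra homomorphism sending each variable \<open>v\<close> to \<open>f v\<close>.\<close>

definition mpoly_subst ::
  "('v \<Rightarrow> ('w, 'k) mpoly) \<Rightarrow> ('v, 'k::comm_ring_1) mpoly \<Rightarrow> ('w, 'k) mpoly" where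
  "mpoly_subst f p =
     (\<Sum>m\<in>Poly_Mapping.keys p. mpoly_const (Poly_Mapping.lookup p m) *
        (\<Prod>v\<in>Poly_Mapping.keys m. f v ^ Poly_Mapping.lookup m v))"

text \<open>
  The second condition says that \<open>fs ! i\<close> is a nonzerodivisor on
  \<open>R / (fs ! 0, \<dots>, fs ! (i - 1))\<close>. The empty sequence is regular in a nonzero ring.
\<close>

definition regular_sequence :: "('a, 'b) ring_scheme \<Rightarrow> 'a list \<Rightarrow> bool" where
  "regular_sequence R fs \<longleftrightarrow>
     set fs \<subseteq> carrier R \<and>
     (\<forall>i<length fs. \<forall>g\<in>carrier R.
        fs ! i \<otimes>\<^bsub>R\<^esub> g \<in> Idl\<^bsub>R\<^esub> (set (take i fs)) \<longrightarrow> g \<in> Idl\<^bsub>R\<^esub> (set (take i fs))) \<and>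
     Idl\<^bsub>R\<^esub> (set fs) \<noteq> carrier R"


section \<open>Hibi rings\<close>

datatype 'a hibi_var = T_var | Z_var 'a

definition hibi_monomial :: "'a set \<Rightarrow> ('a hibi_var, 'k::comm_ring_1) mpoly" where
  "hibi_monomial \<alpha> = mpoly_var T_var * (\<Prod>p\<in>\<alpha>. mpoly_var (Z_var p))"

definition hibi_ambient :: "'a set \<Rightarrow> ('a hibi_var, 'k::comm_ring_1) mpoly ring" where
  "hibi_ambient P = mpoly_ring (insert T_var (Z_var ` P))"

text \<open>Including the constants makes the generated subring the generated \<open>K\<close>-subalgebra.\<close>

definition hibi_ring :: "'a set \<Rightarrow> 'a rel \<Rightarrow> ('a hibi_var, 'k::field) mpoly ring" where
  "hibi_ring P r =
     (hibi_ambient P)\<lparr>carrier :=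
        generate_ring (hibi_ambient P) (range mpoly_const \<union> hibi_monomial ` order_ideals P r)\<rparr>"

text \<open>The variable \<open>x\<^sub>\<alpha>\<close> is \<open>mpoly_var \<alpha>\<close>.\<close>

definition hibi_presentation_ring :: "'a set \<Rightarrow> 'a rel \<Rightarrow> ('a set, 'k::field) mpoly ring" where
  "hibi_presentation_ring P r = mpoly_ring (order_ideals P r)"

definition hibi_relations :: "'a set \<Rightarrow> 'a rel \<Rightarrow> ('a set, 'k::field) mpoly set" where
  "hibi_relations P r =
     {mpoly_var \<alpha> * mpoly_var \<beta> - mpoly_var (\<alpha> \<inter> \<beta>) * mpoly_var (\<alpha> \<union> \<beta>) | \<alpha> \<beta>.
        \<alpha> \<in> order_ideals P r \<and> \<beta> \<in> order_ideals P r \<and> \<not> \<alpha> \<subseteq> \<beta> \<and> \<not> \<beta> \<subseteq> \<alpha>}"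

definition hibi_ideal :: "'a set \<Rightarrow> 'a rel \<Rightarrow> ('a set, 'k::field) mpoly set" where
  "hibi_ideal P r = Idl\<^bsub>hibi_presentation_ring P r\<^esub> (hibi_relations P r)"

text \<open>
  Being a complete intersection is a property of the Hibi ring through its presentation as the
  quotient of \<open>hibi_presentation_ring P r\<close> by \<open>hibi_ideal P r\<close>; that this is a presentation of
  \<open>hibi_ring P r\<close> is proved below as \<open>hibi_ring_presentation\<close>. The \<open>itself\<close>
  argument records the coefficient field.
\<close>

definition hibi_ring_complete_intersection ::
  "'k::field itself \<Rightarrow> 'a set \<Rightarrow> 'a rel \<Rightarrow> bool" where
  "hibi_ring_complete_intersection _ P r \<longleftrightarrow>
     (\<exists>fs. regular_sequence (hibi_presentation_ring P r :: ('a set, 'k) mpoly ring) fs \<and>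
           hibi_ideal P r = Idl\<^bsub>hibi_presentation_ring P r\<^esub> (set fs))"


section \<open>The Hibi ideal is the kernel of the presentation\<close>

abbreviation (input) lkp :: "('a \<Rightarrow>\<^sub>0 'b::zero) \<Rightarrow> 'a \<Rightarrow> 'b" where "lkp \<equiv> Poly_Mapping.lookup"
abbreviation (input) kys :: "('a \<Rightarrow>\<^sub>0 'b::zero) \<Rightarrow> 'a set" where "kys \<equiv> Poly_Mapping.keys"
abbreviation (input) sgl :: "'a \<Rightarrow> 'b \<Rightarrow> 'a \<Rightarrow>\<^sub>0 'b::zero" where "sgl \<equiv> Poly_Mapping.single"

lemma mpoly_ring_simps [simp]:
  "carrier (mpoly_ring V) = {p. \<forall>m\<in>kys p. kys m \<subseteq> V}"
  "x \<otimes>\<^bsub>mpoly_ring V\<^esub> y = x * y" "x \<oplus>\<^bsub>mpoly_ring V\<^esub> y = x + y"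
  "\<one>\<^bsub>mpoly_ring V\<^esub> = 1" "\<zero>\<^bsub>mpoly_ring V\<^esub> = 0"
  by (simp_all add: mpoly_ring_def)

lemma keys_add_nat: "kys (a + b :: 'v \<Rightarrow>\<^sub>0 nat) = kys a \<union> kys b"
  by (auto simp: in_keys_iff lookup_add)

lemma mpoly_carrier_add:
  "p \<in> carrier (mpoly_ring V) \<Longrightarrow> q \<in> carrier (mpoly_ring V) \<Longrightarrow> p + q \<in> carrier (mpoly_ring V)"
  using keys_add[of p q] by (simp add: Ball_def subset_iff) blast

lemma mpoly_carrier_mult:
  "p \<in> carrier (mpoly_ring V) \<Longrightarrow> q \<in> carrier (mpoly_ring V) \<Longrightarrow> p * q \<in> carrier (mpoly_ring V)"
  using keys_mult[of p q] by (simp add: subset_iff keys_add_nat) (metis Un_iff keys_add_nat)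

lemma mpoly_carrier_uminus: "p \<in> carrier (mpoly_ring V) \<Longrightarrow> - p \<in> carrier (mpoly_ring V)"
  by (simp add: in_keys_iff)

lemma mpoly_ring_cring: "cring (mpoly_ring V :: ('v, 'k::comm_ring_1) mpoly ring)"
proof (rule cringI)
  show "abelian_group (mpoly_ring V :: ('v, 'k) mpoly ring)"
  proof (rule abelian_groupI)
    fix x :: "('v, 'k) mpoly" assume "x \<in> carrier (mpoly_ring V)"
    thus "\<exists>y\<in>carrier (mpoly_ring V). y \<oplus>\<^bsub>mpoly_ring V\<^esub> x = \<zero>\<^bsub>mpoly_ring V\<^esub>"
      by (intro bexI[OF _ mpoly_carrier_uminus]) auto
  qed (use mpoly_carrier_add[of _ V] in \<open>simp_all add: add.assoc add.commute\<close>)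
  show "Group.comm_monoid (mpoly_ring V :: ('v, 'k) mpoly ring)"
    by (rule comm_monoidI)
       (use mpoly_carrier_mult[of _ V] in \<open>simp_all add: mult.assoc mult.commute\<close>)
qed (auto simp: distrib_right)

lemma mpoly_ring_uminus:
  assumes "x \<in> carrier (mpoly_ring V)"
  shows "\<ominus>\<^bsub>mpoly_ring V\<^esub> x = - (x :: ('v, 'k::comm_ring_1) mpoly)"
proof -
  interpret cring "mpoly_ring V :: ('v, 'k) mpoly ring" by (rule mpoly_ring_cring)
  show ?thesis
    by (rule sum_zero_eq_neg[symmetric]) (use assms mpoly_carrier_uminus in auto)
qed

lemma mpoly_expansion: "(p :: ('v, 'k::comm_ring_1) mpoly) = (\<Sum>m\<in>kys p. sgl m (lkp p m))"
proof (rule poly_mapping_eqI)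
  fix k
  show "lkp p k = lkp (\<Sum>m\<in>kys p. sgl m (lkp p m)) k"
    by (cases "k \<in> kys p") (auto simp: lookup_sum lookup_single when_def in_keys_iff)
qed

lemma mpoly_induct [case_names zero single add]:
  assumes "P 0" "\<And>m c. P (sgl m c)" "\<And>p q. P p \<Longrightarrow> P q \<Longrightarrow> P (p + q)"
  shows "P (p :: ('v, 'k::comm_ring_1) mpoly)"
proof -
  have "P (\<Sum>m\<in>M. sgl m (lkp p m))" if "finite M" for M
    using that by (induction M) (auto intro: assms)
  from this[OF finite_keys, of p] show ?thesis unfolding mpoly_expansion[of p, symmetric] .
qed

definition mono_subst :: "('v \<Rightarrow> ('w, 'k::comm_ring_1) mpoly) \<Rightarrow> ('v \<Rightarrow>\<^sub>0 nat) \<Rightarrow> ('w, 'k) mpoly" where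
  "mono_subst f m = (\<Prod>v\<in>kys m. f v ^ lkp m v)"

lemma mono_subst_superset:
  "finite M \<Longrightarrow> kys m \<subseteq> M \<Longrightarrow> mono_subst f m = (\<Prod>v\<in>M. f v ^ lkp m v)"
  unfolding mono_subst_def by (rule prod.mono_neutral_left) (auto simp: in_keys_iff)

lemma mono_subst_add: "mono_subst f (a + b) = mono_subst f a * mono_subst f b"
proof -
  have "mono_subst f m = (\<Prod>v\<in>kys a \<union> kys b. f v ^ lkp m v)" if "m \<in> {a, b, a + b}" for m
    by (rule mono_subst_superset) (use that in \<open>auto simp: keys_add_nat\<close>)
  thus ?thesis by (simp add: lookup_add power_add prod.distrib)
qed

lemma mpoly_subst_eq:
  "mpoly_subst f p = (\<Sum>m\<in>kys p. mpoly_const (lkp p m) * mono_subst f m)"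
  by (simp add: mpoly_subst_def mono_subst_def)

lemma mpoly_const_simps [simp]:
  "mpoly_const 0 = 0" "mpoly_const 1 = 1" "mpoly_const (a + b) = mpoly_const a + mpoly_const b"
  "mpoly_const (a * b) = mpoly_const a * mpoly_const b"
  by (simp_all add: mpoly_const_def single_add mult_single)

lemma mpoly_subst_superset:
  "finite M \<Longrightarrow> kys p \<subseteq> M \<Longrightarrow> mpoly_subst f p = (\<Sum>m\<in>M. mpoly_const (lkp p m) * mono_subst f m)"
  unfolding mpoly_subst_eq by (rule sum.mono_neutral_left) (auto simp: in_keys_iff)

lemma mpoly_subst_0 [simp]: "mpoly_subst f 0 = 0"
  by (simp add: mpoly_subst_def)

lemma mpoly_subst_add [simp]: "mpoly_subst f (p + q) = mpoly_subst f p + mpoly_subst f q"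
proof -
  have "mpoly_subst f x = (\<Sum>m\<in>kys p \<union> kys q. mpoly_const (lkp x m) * mono_subst f m)"
    if "x \<in> {p, q, p + q}" for x
    by (rule mpoly_subst_superset) (use that keys_add[of p q] in auto)
  thus ?thesis by (simp add: lookup_add distrib_right sum.distrib)
qed

lemma mpoly_subst_single: "mpoly_subst f (sgl m c) = mpoly_const c * mono_subst f m"
  by (subst mpoly_subst_superset[of "{m}"]) auto

lemma mpoly_subst_mult [simp]: "mpoly_subst f (p * q) = mpoly_subst f p * mpoly_subst f q"
proof (induction p rule: mpoly_induct)
  case (single m c)
  show ?case
    by (induction q rule: mpoly_induct)
       (simp_all add: mult_single mpoly_subst_single mono_subst_add distrib_left distrib_right mult_ac)
qed (simp_all add: distrib_right)

lemma mpoly_subst_1 [simp]: "mpoly_subst f 1 = 1"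
  using mpoly_subst_single[of f 0 1] by (simp add: mono_subst_def)

lemma mpoly_subst_const [simp]: "mpoly_subst f (mpoly_const c) = mpoly_const c"
  by (simp add: mpoly_const_def mpoly_subst_single mono_subst_def)

lemma mpoly_subst_var [simp]: "mpoly_subst f (mpoly_var v) = f v"
  by (simp add: mpoly_var_def mpoly_subst_single mono_subst_def)

lemma mpoly_subst_sum [simp]: "mpoly_subst f (sum g A) = (\<Sum>a\<in>A. mpoly_subst f (g a))"
  by (induction A rule: infinite_finite_induct) simp_all

lemma mpoly_subst_uminus [simp]: "mpoly_subst f (- p) = - mpoly_subst f p"
  using mpoly_subst_add[of f p "- p"] by (simp add: eq_neg_iff_add_eq_0 add.commute)

lemma mpoly_subst_diff [simp]: "mpoly_subst f (p - q) = mpoly_subst f p - mpoly_subst f q"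
  using mpoly_subst_add[of f p "- q"] by simp

definition hibi_exp :: "'a set \<Rightarrow> 'a hibi_var \<Rightarrow>\<^sub>0 nat" where
  "hibi_exp \<alpha> = sgl T_var 1 + (\<Sum>p\<in>\<alpha>. sgl (Z_var p) 1)"

definition hibi_image_exp :: "('a set \<Rightarrow>\<^sub>0 nat) \<Rightarrow> 'a hibi_var \<Rightarrow>\<^sub>0 nat" where
  "hibi_image_exp m = (\<Sum>\<alpha>\<in>kys m. \<Sum>i<lkp m \<alpha>. hibi_exp \<alpha>)"

lemma prod_single_1: "(\<Prod>x\<in>A. sgl (g x) (1::'k::comm_ring_1)) = sgl (\<Sum>x\<in>A. g x :: 'w \<Rightarrow>\<^sub>0 nat) 1"
  by (induction A rule: infinite_finite_induct) (simp_all add: mult_single)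

lemma power_single_1: "sgl (e :: 'w \<Rightarrow>\<^sub>0 nat) (1::'k::comm_ring_1) ^ n = sgl (\<Sum>i<n. e) 1"
  by (induction n) (simp_all add: mult_single add.commute)

lemma hibi_monomial_eq: "hibi_monomial \<alpha> = sgl (hibi_exp \<alpha>) 1"
  by (simp add: hibi_monomial_def mpoly_var_def prod_single_1 mult_single hibi_exp_def)

lemma mono_subst_hibi: "mono_subst hibi_monomial m = sgl (hibi_image_exp m) 1"
  by (simp add: mono_subst_def hibi_monomial_eq power_single_1 prod_single_1 hibi_image_exp_def)

lemma mpoly_subst_hibi_single: "mpoly_subst hibi_monomial (sgl m c) = sgl (hibi_image_exp m) c"
  by (simp add: mpoly_subst_single mono_subst_hibi mpoly_const_def mult_single)

lemma single_1_inject: "sgl a (1::rat) = sgl b 1 \<longleftrightarrow> a = b"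
  by (metis keys_single one_neq_zero singleton_inject)

lemma hibi_image_exp_add: "hibi_image_exp (a + b) = hibi_image_exp a + hibi_image_exp b"
proof -
  have "sgl (hibi_image_exp (a + b)) (1::rat) = sgl (hibi_image_exp a + hibi_image_exp b) 1"
    unfolding mono_subst_hibi[symmetric] mono_subst_add by (simp add: mono_subst_hibi mult_single)
  thus ?thesis by (simp only: single_1_inject)
qed

lemma hibi_image_exp_0 [simp]: "hibi_image_exp 0 = 0"
  by (simp add: hibi_image_exp_def)

lemma hibi_image_exp_single [simp]: "hibi_image_exp (sgl \<alpha> 1) = hibi_exp \<alpha>"
  by (simp add: hibi_image_exp_def)

lemma lookup_hibi_exp_T [simp]: "lkp (hibi_exp \<alpha>) T_var = 1"
  by (simp add: hibi_exp_def lookup_add lookup_sum lookup_single)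

lemma lookup_hibi_exp_Z: "finite \<alpha> \<Longrightarrow> lkp (hibi_exp \<alpha>) (Z_var p) = (if p \<in> \<alpha> then 1 else 0)"
  by (simp add: hibi_exp_def lookup_add lookup_sum lookup_single when_def)

lemma lookup_image_T: "lkp (hibi_image_exp m) T_var = (\<Sum>\<alpha>\<in>kys m. lkp m \<alpha>)"
  by (simp add: hibi_image_exp_def lookup_sum)

lemma hibi_image_exp_eq_0: "hibi_image_exp m = 0 \<longleftrightarrow> m = 0"
proof
  assume "hibi_image_exp m = 0"
  hence "(\<Sum>\<alpha>\<in>kys m. lkp m \<alpha>) = 0" by (metis lookup_image_T lookup_zero)
  hence "lkp m \<alpha> = 0" for \<alpha> by (cases "\<alpha> \<in> kys m") (auto simp: in_keys_iff)
  thus "m = 0" by (intro poly_mapping_eqI) simp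
qed simp

lemma image_support:
  assumes "\<And>\<alpha>. \<alpha> \<in> kys m \<Longrightarrow> finite \<alpha>"
  shows "{p. lkp (hibi_image_exp m) (Z_var p) \<noteq> 0} = \<Union> (kys m)"
  using assms by (auto simp: hibi_image_exp_def lookup_sum lookup_hibi_exp_Z in_keys_iff
      split: if_splits)

lemma monomial_split:
  assumes "v \<in> kys (m :: 'v \<Rightarrow>\<^sub>0 nat)"
  obtains m' where "m = m' + sgl v 1"
proof
  show "m = (m - sgl v 1) + sgl v 1"
    using assms by (intro poly_mapping_eqI)
      (auto simp: lookup_add lookup_minus lookup_single when_def in_keys_iff)
qed

definition cong_mono ::
  "('v \<Rightarrow>\<^sub>0 nat) \<Rightarrow> ('v, 'k::comm_ring_1) mpoly set \<Rightarrow> ('v \<Rightarrow>\<^sub>0 nat) \<Rightarrow> bool"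
  (\<open>_ \<bowtie>[_] _\<close> [51, 0, 51] 50) where
  "m \<bowtie>[I] m' \<longleftrightarrow> sgl m 1 - sgl m' 1 \<in> I"

context
  fixes P :: "'a set" and r :: "'a rel" and S :: "('a set, 'k::field) mpoly ring"
    and I :: "('a set, 'k) mpoly set"
  assumes fin: "finite P"
  defines "S \<equiv> hibi_presentation_ring P r" and "I \<equiv> hibi_ideal P r"
begin

interpretation S: cring S
  unfolding S_def hibi_presentation_ring_def by (rule mpoly_ring_cring)

lemma S_simps:
  "carrier S = {p. \<forall>m\<in>kys p. kys m \<subseteq> order_ideals P r}"
  "x \<otimes>\<^bsub>S\<^esub> y = x * y" "x \<oplus>\<^bsub>S\<^esub> y = x + y" "\<one>\<^bsub>S\<^esub> = 1" "\<zero>\<^bsub>S\<^esub> = 0"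
  by (simp_all add: S_def hibi_presentation_ring_def)

lemma order_ideals_Int_Un:
  assumes "\<alpha> \<in> order_ideals P r" "\<beta> \<in> order_ideals P r"
  shows "\<alpha> \<inter> \<beta> \<in> order_ideals P r" "\<alpha> \<union> \<beta> \<in> order_ideals P r"
  using assms by (auto simp: order_ideals_def)

lemma order_ideals_finite: "\<alpha> \<in> order_ideals P r \<Longrightarrow> finite \<alpha>"
  using fin by (auto simp: order_ideals_def intro: finite_subset)

lemma hibi_binomial_eq:
  "mpoly_var \<alpha> * mpoly_var \<beta> - mpoly_var (\<alpha> \<inter> \<beta>) * mpoly_var (\<alpha> \<union> \<beta>) =
   (sgl (sgl \<alpha> 1 + sgl \<beta> 1) 1 - sgl (sgl (\<alpha> \<inter> \<beta>) 1 + sgl (\<alpha> \<union> \<beta>) 1) 1 :: ('a set, 'k) mpoly)"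
  by (simp add: mpoly_var_def mult_single)

lemma single_in_S: "kys m \<subseteq> order_ideals P r \<Longrightarrow> sgl m c \<in> carrier S"
  by (auto simp: S_simps)

lemma diff_in_S: "p \<in> carrier S \<Longrightarrow> q \<in> carrier S \<Longrightarrow> p - q \<in> carrier S"
  unfolding S_def hibi_presentation_ring_def diff_conv_add_uminus
  by (intro mpoly_carrier_add mpoly_carrier_uminus)

lemma relations_in_S: "hibi_relations P r \<subseteq> carrier S"
proof
  fix p :: "('a set, 'k) mpoly" assume "p \<in> hibi_relations P r"
  then obtain \<alpha> \<beta> where p: "p = sgl (sgl \<alpha> 1 + sgl \<beta> 1) 1 - sgl (sgl (\<alpha> \<inter> \<beta>) 1 + sgl (\<alpha> \<union> \<beta>) 1) 1"
    and \<alpha>\<beta>: "\<alpha> \<in> order_ideals P r" "\<beta> \<in> order_ideals P r"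
    unfolding hibi_relations_def hibi_binomial_eq by blast
  show "p \<in> carrier S"
    unfolding p using \<alpha>\<beta> order_ideals_Int_Un[OF \<alpha>\<beta>]
    by (intro diff_in_S single_in_S) (simp_all add: keys_add_nat)
qed

lemma I_ideal: "ideal I S"
  unfolding I_def hibi_ideal_def S_def[symmetric] by (rule S.genideal_ideal[OF relations_in_S])

lemma I_add: "p \<in> I \<Longrightarrow> q \<in> I \<Longrightarrow> p + q \<in> I"
  using additive_subgroup.a_closed[OF ideal.axioms(1)[OF I_ideal]] by (simp add: S_simps)

lemma I_0: "0 \<in> I"
  using additive_subgroup.zero_closed[OF ideal.axioms(1)[OF I_ideal]] by (simp add: S_simps)

lemma I_mult: "p \<in> I \<Longrightarrow> q \<in> carrier S \<Longrightarrow> q * p \<in> I"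
  using ideal.I_l_closed[OF I_ideal] by (simp add: S_simps(2))

lemma I_uminus: "p \<in> I \<Longrightarrow> - p \<in> I"
  using I_mult[of p "sgl 0 (-1)"] single_in_S[of 0 "-1"] by (simp add: single_uminus)

lemma I_sum: "(\<And>a. a \<in> A \<Longrightarrow> g a \<in> I) \<Longrightarrow> sum g A \<in> I"
  by (induction A rule: infinite_finite_induct) (auto simp: I_0 I_add)

lemma cong_refl: "m \<bowtie>[I] m"
  by (simp add: cong_mono_def I_0)

lemma cong_sym: "m \<bowtie>[I] m' \<Longrightarrow> m' \<bowtie>[I] m"
  unfolding cong_mono_def using I_uminus by fastforce

lemma cong_trans: "a \<bowtie>[I] b \<Longrightarrow> b \<bowtie>[I] c \<Longrightarrow> a \<bowtie>[I] c"
  unfolding cong_mono_def using I_add by fastforce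

lemma cong_add:
  assumes "a \<bowtie>[I] b" "kys c \<subseteq> order_ideals P r"
  shows "c + a \<bowtie>[I] c + b"
proof -
  have "sgl c 1 * (sgl a 1 - sgl b 1) \<in> I"
    using assms by (intro I_mult single_in_S) (auto simp: cong_mono_def)
  thus ?thesis by (simp add: cong_mono_def right_diff_distrib mult_single)
qed

lemma cong_straighten:
  assumes "\<alpha> \<in> order_ideals P r" "\<beta> \<in> order_ideals P r"
  shows "sgl \<alpha> 1 + sgl \<beta> 1 \<bowtie>[I] sgl (\<alpha> \<inter> \<beta>) 1 + sgl (\<alpha> \<union> \<beta>) 1"
proof -
  consider "\<alpha> \<subseteq> \<beta>" | "\<beta> \<subseteq> \<alpha>" | "\<not> \<alpha> \<subseteq> \<beta>" "\<not> \<beta> \<subseteq> \<alpha>" by blast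
  thus ?thesis
  proof cases
    case 1
    hence "\<alpha> \<inter> \<beta> = \<alpha>" "\<alpha> \<union> \<beta> = \<beta>" by auto
    thus ?thesis by (simp add: cong_refl)
  next
    case 2
    hence "\<alpha> \<inter> \<beta> = \<beta>" "\<alpha> \<union> \<beta> = \<alpha>" by auto
    thus ?thesis by (simp add: cong_refl add.commute)
  next
    case 3
    have "sgl (sgl \<alpha> 1 + sgl \<beta> 1) 1 - sgl (sgl (\<alpha> \<inter> \<beta>) 1 + sgl (\<alpha> \<union> \<beta>) 1) (1::'k)
        \<in> hibi_relations P r"
      unfolding hibi_relations_def hibi_binomial_eq[symmetric] using assms 3 by blast
    thus ?thesis
      unfolding cong_mono_def I_def hibi_ideal_def S_def[symmetric]
      using S.genideal_self[OF relations_in_S] by blast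
  qed
qed

lemma cong_extract_top:
  assumes "m \<noteq> 0" "kys m \<subseteq> order_ideals P r"
  shows "\<exists>n. kys n \<subseteq> order_ideals P r \<and> \<Union> (kys m) \<in> order_ideals P r \<and>
           m \<bowtie>[I] n + sgl (\<Union> (kys m)) 1"
  using assms
proof (induction "\<Sum>\<alpha>\<in>kys m. lkp m \<alpha>" arbitrary: m rule: less_induct)
  case less
  from less.prems(1) obtain \<alpha> where \<alpha>: "\<alpha> \<in> kys m" by (auto simp flip: keys_eq_empty)
  then obtain m0 where m: "m = m0 + sgl \<alpha> 1" by (rule monomial_split)
  have \<alpha>I: "\<alpha> \<in> order_ideals P r" and m0I: "kys m0 \<subseteq> order_ideals P r"
    using less.prems(2) by (auto simp: m keys_add_nat)
  show ?case
  proof (cases "m0 = 0")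
    case True
    thus ?thesis using \<alpha>I by (intro exI[of _ 0]) (simp add: m cong_refl)
  next
    case False
    have "(\<Sum>\<alpha>\<in>kys m0. lkp m0 \<alpha>) < (\<Sum>\<alpha>\<in>kys m. lkp m \<alpha>)"
      unfolding lookup_image_T[symmetric]
      unfolding m hibi_image_exp_add lookup_add hibi_image_exp_single by simp
    from less.hyps[OF this False m0I] obtain n
      where n: "kys n \<subseteq> order_ideals P r" and \<beta>I: "\<Union> (kys m0) \<in> order_ideals P r"
        and m0: "m0 \<bowtie>[I] n + sgl (\<Union> (kys m0)) 1" by blast
    let ?\<beta> = "\<Union> (kys m0)"
    have U: "\<Union> (kys m) = \<alpha> \<union> ?\<beta>" by (auto simp: m keys_add_nat)
    have "m \<bowtie>[I] n + (sgl \<alpha> 1 + sgl ?\<beta> 1)"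
      using cong_add[OF m0, of "sgl \<alpha> 1"] \<alpha>I by (simp add: m ac_simps)
    also have "n + (sgl \<alpha> 1 + sgl ?\<beta> 1) \<bowtie>[I] n + (sgl (\<alpha> \<inter> ?\<beta>) 1 + sgl (\<alpha> \<union> ?\<beta>) 1)"
      by (intro cong_add cong_straighten \<alpha>I \<beta>I n)
    finally (cong_trans) show ?thesis
      unfolding U using n order_ideals_Int_Un[OF \<alpha>I \<beta>I]
      by (intro exI[of _ "n + sgl (\<alpha> \<inter> ?\<beta>) 1"]) (simp add: keys_add_nat add.assoc)
  qed
qed

lemma relations_in_kernel:
  assumes "p \<in> hibi_relations P r"
  shows "mpoly_subst hibi_monomial p = (0 :: ('a hibi_var, 'k) mpoly)"
proof -
  from assms obtain \<alpha> \<beta> where p: "p = mpoly_var \<alpha> * mpoly_var \<beta> - mpoly_var (\<alpha> \<inter> \<beta>) * mpoly_var (\<alpha> \<union> \<beta>)"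
    and "\<alpha> \<in> order_ideals P r" "\<beta> \<in> order_ideals P r"
    by (auto simp: hibi_relations_def)
  hence "finite \<alpha>" "finite \<beta>" by (auto simp: order_ideals_finite)
  from prod.union_inter[OF this, of "\<lambda>p. mpoly_var (Z_var p) :: ('a hibi_var, 'k) mpoly"]
  show ?thesis by (simp add: p hibi_monomial_def mult_ac)
qed

lemma hibi_ring_hom:
  "ring_hom_ring S (hibi_ambient P) (mpoly_subst hibi_monomial)"
proof -
  have "mpoly_subst hibi_monomial p \<in> carrier (hibi_ambient P :: ('a hibi_var, 'k) mpoly ring)"
    if p: "p \<in> carrier S" for p
  proof -
    have 1: "kys (hibi_image_exp m) \<subseteq> insert T_var (Z_var ` P)" if "m \<in> kys p" for m
    proof
      fix x assume x: "x \<in> kys (hibi_image_exp m)"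
      have m: "kys m \<subseteq> order_ideals P r" using p that by (auto simp: S_simps)
      show "x \<in> insert T_var (Z_var ` P)"
      proof (cases x)
        case (Z_var q)
        have "{p. lkp (hibi_image_exp m) (Z_var p) \<noteq> 0} = \<Union> (kys m)"
          by (rule image_support) (use m order_ideals_finite in blast)
        moreover have "lkp (hibi_image_exp m) (Z_var q) \<noteq> 0"
          using x unfolding Z_var in_keys_iff .
        ultimately have "q \<in> \<Union> (kys m)" by blast
        thus ?thesis using m Z_var by (auto simp: order_ideals_def)
      qed auto
    qed
    have "mpoly_subst hibi_monomial p = (\<Sum>m\<in>kys p. sgl (hibi_image_exp m) (lkp p m))"
      by (subst mpoly_expansion[of p]) (simp add: mpoly_subst_hibi_single)
    also have "kys \<dots> \<subseteq> hibi_image_exp ` kys p"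
      by (rule order_trans[OF keys_sum]) auto
    finally show ?thesis using 1 by (auto simp: hibi_ambient_def)
  qed
  thus ?thesis
    unfolding hibi_ambient_def
    by (intro ring_hom_ringI cring.axioms(1)[OF mpoly_ring_cring] S.ring_axioms)
       (auto simp: S_simps)
qed

interpretation H: ring_hom_ring S "hibi_ambient P" "mpoly_subst hibi_monomial"
  by (rule hibi_ring_hom)

lemma kernel_iff:
  "p \<in> a_kernel S (hibi_ambient P) (mpoly_subst hibi_monomial) \<longleftrightarrow>
     p \<in> carrier S \<and> mpoly_subst hibi_monomial p = (0 :: ('a hibi_var, 'k) mpoly)"
  unfolding a_kernel_def' hibi_ambient_def mpoly_ring_simps by blast

lemma ideal_subset_kernel: "p \<in> I \<Longrightarrow> mpoly_subst hibi_monomial p = (0 :: ('a hibi_var, 'k) mpoly)"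
proof -
  have "hibi_relations P r \<subseteq> a_kernel S (hibi_ambient P) (mpoly_subst hibi_monomial)"
    using relations_in_S relations_in_kernel unfolding subset_iff kernel_iff by blast
  from S.genideal_minimal[OF H.kernel_is_ideal this]
  have "I \<subseteq> a_kernel S (hibi_ambient P) (mpoly_subst hibi_monomial)"
    unfolding I_def hibi_ideal_def S_def .
  thus "p \<in> I \<Longrightarrow> ?thesis" unfolding subset_iff kernel_iff by blast
qed

lemma cong_image: "m \<bowtie>[I] m' \<Longrightarrow> hibi_image_exp m = hibi_image_exp m'"
proof -
  assume "m \<bowtie>[I] m'"
  from ideal_subset_kernel[OF this[unfolded cong_mono_def]]
  have "sgl (hibi_image_exp m) 1 = sgl (hibi_image_exp m') (1::'k)"
    by (simp add: mpoly_subst_hibi_single)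
  hence "kys (sgl (hibi_image_exp m) (1::'k)) = kys (sgl (hibi_image_exp m') (1::'k))" by simp
  thus ?thesis by simp
qed

lemma cong_if_image_eq:
  assumes "kys m \<subseteq> order_ideals P r" "kys m' \<subseteq> order_ideals P r"
    "hibi_image_exp m = hibi_image_exp m'"
  shows "m \<bowtie>[I] m'"
  using assms
proof (induction "lkp (hibi_image_exp m) T_var" arbitrary: m m' rule: less_induct)
  case less
  show ?case
  proof (cases "m = 0")
    case True
    hence "m' = 0" using less.prems(3) by (metis hibi_image_exp_eq_0)
    thus ?thesis using True by (simp add: cong_refl)
  next
    case False
    hence nz: "m' \<noteq> 0" using less.prems(3) by (metis hibi_image_exp_eq_0)
    let ?\<gamma> = "\<Union> (kys m)"
    have U: "\<Union> (kys m') = ?\<gamma>"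
    proof -
      have "\<Union> (kys m') = {p. lkp (hibi_image_exp m') (Z_var p) \<noteq> 0}"
        by (rule image_support[symmetric]) (use less.prems(2) order_ideals_finite in blast)
      also have "\<dots> = \<Union> (kys m)"
        unfolding less.prems(3)[symmetric]
        by (rule image_support) (use less.prems(1) order_ideals_finite in blast)
      finally show ?thesis .
    qed
    obtain n where n: "kys n \<subseteq> order_ideals P r" "?\<gamma> \<in> order_ideals P r" "m \<bowtie>[I] n + sgl ?\<gamma> 1"
      using cong_extract_top[OF False less.prems(1)] by blast
    obtain n' where n': "kys n' \<subseteq> order_ideals P r" "m' \<bowtie>[I] n' + sgl ?\<gamma> 1"
      using cong_extract_top[OF nz less.prems(2)] unfolding U by blast
    have e: "hibi_image_exp m = hibi_image_exp n + hibi_exp ?\<gamma>"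
      using cong_image[OF n(3)] by (simp only: hibi_image_exp_add hibi_image_exp_single)
    moreover have "hibi_image_exp m' = hibi_image_exp n' + hibi_exp ?\<gamma>"
      using cong_image[OF n'(2)] by (simp only: hibi_image_exp_add hibi_image_exp_single)
    ultimately have e': "hibi_image_exp n = hibi_image_exp n'" using less.prems(3) by simp
    have "lkp (hibi_image_exp n) T_var < lkp (hibi_image_exp m) T_var"
      by (simp add: e lookup_add)
    from cong_add[OF less.hyps[OF this n(1) n'(1) e'], of "sgl ?\<gamma> 1"] n(2)
    have "n + sgl ?\<gamma> 1 \<bowtie>[I] n' + sgl ?\<gamma> 1" by (simp add: add.commute)
    thus ?thesis using n(3) cong_sym[OF n'(2)] cong_trans by blast
  qed
qed

lemma kernel_subset_ideal:
  assumes p: "p \<in> carrier S" and 0: "mpoly_subst hibi_monomial p = (0 :: ('a hibi_var, 'k) mpoly)"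
  shows "p \<in> I"
proof -
  define E where "E = hibi_image_exp ` kys p"
  define rep where "rep e = (SOME m. m \<in> kys p \<and> hibi_image_exp m = e)" for e
  have rep: "rep e \<in> kys p \<and> hibi_image_exp (rep e) = e" if "e \<in> E" for e
    unfolding rep_def using that[unfolded E_def]
    by (intro someI_ex[of "\<lambda>m. m \<in> kys p \<and> hibi_image_exp m = e"]) auto
  have coeff: "(\<Sum>m | m \<in> kys p \<and> hibi_image_exp m = e. lkp p m) = 0" for e
  proof -
    have "mpoly_subst hibi_monomial p = (\<Sum>m\<in>kys p. sgl (hibi_image_exp m) (lkp p m))"
      by (subst mpoly_expansion[of p]) (simp add: mpoly_subst_hibi_single)
    hence "0 = lkp (\<Sum>m\<in>kys p. sgl (hibi_image_exp m) (lkp p m)) e" using 0 by simp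
    also have "lkp (\<Sum>m\<in>kys p. sgl (hibi_image_exp m) (lkp p m)) e =
        (\<Sum>m\<in>kys p. if hibi_image_exp m = e then lkp p m else 0)"
      unfolding lookup_sum lookup_single when_def ..
    also have "\<dots> = (\<Sum>m | m \<in> kys p \<and> hibi_image_exp m = e. lkp p m)"
      by (rule sum.inter_filter[symmetric]) simp
    finally show ?thesis by (rule sym)
  qed
  have "(\<Sum>m\<in>kys p. sgl (rep (hibi_image_exp m)) (lkp p m)) =
        (\<Sum>e\<in>E. \<Sum>m | m \<in> kys p \<and> hibi_image_exp m = e. sgl (rep (hibi_image_exp m)) (lkp p m))"
    unfolding E_def by (rule sum.image_gen) simp
  also have "\<dots> = (\<Sum>e\<in>E. sgl (rep e) (\<Sum>m | m \<in> kys p \<and> hibi_image_exp m = e. lkp p m))"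
  proof (intro sum.cong refl)
    fix e
    have single_sum: "sgl (rep e) (\<Sum>m\<in>M. lkp p m) = (\<Sum>m\<in>M. sgl (rep e) (lkp p m))" for M
      by (induction M rule: infinite_finite_induct) (simp_all add: single_add)
    show "(\<Sum>m | m \<in> kys p \<and> hibi_image_exp m = e. sgl (rep (hibi_image_exp m)) (lkp p m)) =
       sgl (rep e) (\<Sum>m | m \<in> kys p \<and> hibi_image_exp m = e. lkp p m)"
      unfolding single_sum by (rule sum.cong) auto
  qed
  also have "\<dots> = 0" by (simp add: coeff)
  finally have "(\<Sum>m\<in>kys p. sgl m (lkp p m) - sgl (rep (hibi_image_exp m)) (lkp p m)) = p"
    unfolding sum_subtractf mpoly_expansion[of p, symmetric] by simp
  hence "p = (\<Sum>m\<in>kys p. sgl m (lkp p m) - sgl (rep (hibi_image_exp m)) (lkp p m))" ..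
  also have "\<dots> \<in> I"
  proof (rule I_sum)
    fix m assume m: "m \<in> kys p"
    have r: "rep (hibi_image_exp m) \<in> kys p" "hibi_image_exp (rep (hibi_image_exp m)) = hibi_image_exp m"
      using rep[of "hibi_image_exp m"] m by (auto simp: E_def)
    have "m \<bowtie>[I] rep (hibi_image_exp m)"
      using p m r by (intro cong_if_image_eq) (auto simp: S_simps)
    hence "sgl 0 (lkp p m) * (sgl m 1 - sgl (rep (hibi_image_exp m)) 1) \<in> I"
      by (intro I_mult single_in_S) (auto simp: cong_mono_def)
    thus "sgl m (lkp p m) - sgl (rep (hibi_image_exp m)) (lkp p m) \<in> I"
      by (simp add: right_diff_distrib mult_single)
  qed
  finally show ?thesis .
qed

lemma kernel_eq_I: "a_kernel S (hibi_ambient P) (mpoly_subst hibi_monomial) = I"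
  using kernel_subset_ideal ideal_subset_kernel ideal.Icarr[OF I_ideal]
  unfolding set_eq_iff kernel_iff by blast

lemma image_eq_hibi_ring:
  "mpoly_subst hibi_monomial ` carrier S = (carrier (hibi_ring P r) :: ('a hibi_var, 'k) mpoly set)"
proof -
  let ?T = "hibi_ambient P :: ('a hibi_var, 'k) mpoly ring"
  let ?G = "range mpoly_const \<union> hibi_monomial ` order_ideals P r :: ('a hibi_var, 'k) mpoly set"
  have T_simps: "x \<otimes>\<^bsub>?T\<^esub> y = x * y" "x \<oplus>\<^bsub>?T\<^esub> y = x + y" "\<one>\<^bsub>?T\<^esub> = 1" for x y
    by (simp_all add: hibi_ambient_def)
  have const: "mpoly_const c \<in> carrier S" for c
    unfolding mpoly_const_def by (rule single_in_S) simp
  have var: "mpoly_var \<alpha> \<in> carrier S" if "\<alpha> \<in> order_ideals P r" for \<alpha>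
    unfolding mpoly_var_def by (rule single_in_S) (use that in auto)
  have G: "?G \<subseteq> mpoly_subst hibi_monomial ` carrier S"
  proof (intro Un_least image_subsetI)
    fix c :: 'k
    show "mpoly_const c \<in> mpoly_subst hibi_monomial ` carrier S"
      using imageI[OF const, of "mpoly_subst hibi_monomial" c] by simp
  next
    fix \<alpha> assume "\<alpha> \<in> order_ideals P r"
    from imageI[OF var[OF this], of "mpoly_subst hibi_monomial"]
    show "hibi_monomial \<alpha> \<in> mpoly_subst hibi_monomial ` carrier S" by simp
  qed
  have "generate_ring ?T ?G \<subseteq> mpoly_subst hibi_monomial ` carrier S"
  proof (rule H.S.generate_ring_min_subring1[OF _ _ G])
    have "mpoly_subst hibi_monomial ` carrier S \<subseteq> carrier ?T"
      by (rule image_subsetI) (rule H.hom_closed)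
    with G show "?G \<subseteq> carrier ?T" by (rule order_trans)
    show "subring (mpoly_subst hibi_monomial ` carrier S) ?T"
      by (rule H.img_is_subring[OF S.carrier_is_subring])
  qed
  moreover have "mpoly_subst hibi_monomial p \<in> generate_ring ?T ?G" if p: "p \<in> carrier S" for p
  proof -
    have mult: "x \<in> generate_ring ?T ?G \<Longrightarrow> y \<in> generate_ring ?T ?G \<Longrightarrow> x * y \<in> generate_ring ?T ?G"
      and add: "x \<in> generate_ring ?T ?G \<Longrightarrow> y \<in> generate_ring ?T ?G \<Longrightarrow> x + y \<in> generate_ring ?T ?G" for x y
      using generate_ring.eng_mult[of x ?T ?G y] generate_ring.eng_add[of x ?T ?G y]
      by (simp_all add: T_simps)
    have one: "1 \<in> generate_ring ?T ?G" using generate_ring.one[of ?T ?G] by (simp add: T_simps)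
    have con: "mpoly_const c \<in> generate_ring ?T ?G" for c by (rule generate_ring.incl) auto
    have zero: "0 \<in> generate_ring ?T ?G" using con[of 0] by simp
    have pow: "x ^ n \<in> generate_ring ?T ?G" if "x \<in> generate_ring ?T ?G" for x n
      using that by (induction n) (auto simp: one mult)
    have prod: "prod g A \<in> generate_ring ?T ?G" if "\<And>a. a \<in> A \<Longrightarrow> g a \<in> generate_ring ?T ?G"
      for g and A :: "'a set set"
      using that by (induction A rule: infinite_finite_induct) (auto simp: one mult)
    have sum: "sum g A \<in> generate_ring ?T ?G" if "\<And>a. a \<in> A \<Longrightarrow> g a \<in> generate_ring ?T ?G"
      for g and A :: "('a set \<Rightarrow>\<^sub>0 nat) set"
      using that by (induction A rule: infinite_finite_induct) (auto simp: zero add)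
    have "hibi_monomial \<alpha> \<in> generate_ring ?T ?G" if "m \<in> kys p" "\<alpha> \<in> kys m" for m \<alpha>
    proof (rule generate_ring.incl)
      have "\<alpha> \<in> order_ideals P r" using p that unfolding S_simps by blast
      thus "hibi_monomial \<alpha> \<in> ?G" by blast
    qed
    thus ?thesis
      unfolding mpoly_subst_def by (intro sum mult con prod pow)
  qed
  ultimately show ?thesis by (auto simp: hibi_ring_def)
qed

end

theorem hibi_ideal_eq_kernel:
  assumes "finite P"
  shows "(hibi_ideal P r :: ('a set, 'k::field) mpoly set) =
     a_kernel (hibi_presentation_ring P r) (hibi_ring P r) (mpoly_subst hibi_monomial)"
  by (subst kernel_eq_I[OF assms, symmetric]) (simp add: a_kernel_def' hibi_ring_def)

theorem hibi_ring_presentation: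
  assumes "finite P"
  shows "(\<lambda>A. the_elem (mpoly_subst hibi_monomial ` A)) \<in>
     ring_iso (hibi_presentation_ring P r Quot hibi_ideal P r)
       (hibi_ring P r :: ('a hibi_var, 'k::field) mpoly ring)"
proof -
  have "(hibi_ambient P)\<lparr>carrier := mpoly_subst hibi_monomial ` carrier (hibi_presentation_ring P r)\<rparr>
      = (hibi_ring P r :: ('a hibi_var, 'k) mpoly ring)"
    unfolding image_eq_hibi_ring[OF assms] by (simp add: hibi_ring_def)
  thus ?thesis
    using ring_hom_ring.FactRing_iso_set_aux[OF hibi_ring_hom[OF assms, of r, where 'k = 'k]]
    unfolding kernel_eq_I[OF assms] by simp
qed

end

theory Submission
  imports Defs
begin

text \<open>
  Both conditions are equivalent to every element of \<open>P\<close> being incomparable to at most one other.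

  If \<open>p\<close> is incomparable to two elements, the order ideals contain a \<open>2 \<times> 3\<close> grid, whose minors are
  Hibi relations satisfying a linear syzygy. This is impossible for a complete intersection: the
  coefficients of a syzygy of a regular sequence lie in the ideal it generates, which here has no
  elements of order below \<open>2\<close>, so that linear relations between quadrics of the ideal are trivial.

  Conversely, if incomparable partners are unique, then so are those of order ideals, and the
  Hibi relations have the form \<open>x\<^sub>\<alpha> x\<^sub>\<beta> - q\<close> with pairwise disjoint pairs \<open>{\<alpha>, \<beta>}\<close> whose variables
  do not occur in any of the \<open>q\<close>; such binomials form a regular sequence in any order.
\<close>

section \<open>Ideals of polynomial rings\<close>

declare mpoly_ring_simps(1) [simp del]

lemma mpoly_carrier_iff: "p \<in> carrier (mpoly_ring V) \<longleftrightarrow> (\<forall>m\<in>kys p. kys m \<subseteq> V)"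
  by (simp add: mpoly_ring_simps(1))

lemma mpoly_carrier_0: "0 \<in> carrier (mpoly_ring V)"
  by (simp add: mpoly_carrier_iff)

lemma mpoly_carrier_single: "kys m \<subseteq> V \<Longrightarrow> sgl m c \<in> carrier (mpoly_ring V)"
  by (simp add: mpoly_carrier_iff)

lemma mpoly_carrier_var: "v \<in> V \<Longrightarrow> mpoly_var v \<in> carrier (mpoly_ring V)"
  by (simp add: mpoly_var_def mpoly_carrier_single)

lemma mpoly_carrier_diff:
  "p \<in> carrier (mpoly_ring V) \<Longrightarrow> q \<in> carrier (mpoly_ring V) \<Longrightarrow> p - q \<in> carrier (mpoly_ring V)"
  unfolding diff_conv_add_uminus by (intro mpoly_carrier_add mpoly_carrier_uminus)

lemma mpoly_carrier_sum:
  "(\<And>i. i \<in> A \<Longrightarrow> g i \<in> carrier (mpoly_ring V)) \<Longrightarrow> sum g A \<in> carrier (mpoly_ring V)"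
  by (induction A rule: infinite_finite_induct) (auto simp: mpoly_carrier_0 intro: mpoly_carrier_add)

lemmas mpoly_carrier_intros = mpoly_carrier_0 mpoly_carrier_var mpoly_carrier_diff
  mpoly_carrier_sum mpoly_carrier_add mpoly_carrier_mult mpoly_carrier_uminus

text \<open>Absorption applied to \<open>- 1\<close> supplies additive inverses, and commutativity
  turns one-sided absorption into two-sided absorption.\<close>

lemma mpoly_idealI:
  fixes J :: "('v, 'k::comm_ring_1) mpoly set"
  assumes "J \<subseteq> carrier (mpoly_ring V)" "0 \<in> J" "\<And>p q. p \<in> J \<Longrightarrow> q \<in> J \<Longrightarrow> p + q \<in> J"
    and mult: "\<And>p q. p \<in> J \<Longrightarrow> q \<in> carrier (mpoly_ring V) \<Longrightarrow> q * p \<in> J"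
  shows "ideal J (mpoly_ring V)"
proof -
  interpret cring "mpoly_ring V :: ('v, 'k) mpoly ring" by (rule mpoly_ring_cring)
  have "- p \<in> J" if "p \<in> J" for p
    using mult[OF that, of "- 1"] mpoly_carrier_uminus[OF one_closed] by simp
  hence "subgroup J (add_monoid (mpoly_ring V))"
    using assms(1-3) mpoly_ring_uminus[where 'k = 'k and V = V]
    by (intro subgroup.intro) (auto simp: a_inv_def subset_iff)
  thus ?thesis
    using mult by (intro idealI ring_axioms) (auto simp: mult.commute)
qed

lemma mpoly_genideal_minimal:
  assumes "ideal J (mpoly_ring V)" "A \<subseteq> J"
  shows "Idl\<^bsub>mpoly_ring V\<^esub> A \<subseteq> (J :: ('v, 'k::comm_ring_1) mpoly set)"
  by (rule ring.genideal_minimal[OF cring.axioms(1)[OF mpoly_ring_cring] assms])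

context
  fixes V :: "'v set" and A :: "('v, 'k::comm_ring_1) mpoly set"
  assumes A: "A \<subseteq> carrier (mpoly_ring V)"
begin

interpretation cring "mpoly_ring V :: ('v, 'k) mpoly ring" by (rule mpoly_ring_cring)

lemma mpoly_genideal_self: "p \<in> A \<Longrightarrow> p \<in> Idl\<^bsub>mpoly_ring V\<^esub> A"
  using genideal_self[OF A] by blast

lemma mpoly_genideal_0: "0 \<in> Idl\<^bsub>mpoly_ring V\<^esub> A"
  using additive_subgroup.zero_closed[OF ideal.axioms(1)[OF genideal_ideal[OF A]]] by simp

lemma mpoly_genideal_add:
  "p \<in> Idl\<^bsub>mpoly_ring V\<^esub> A \<Longrightarrow> q \<in> Idl\<^bsub>mpoly_ring V\<^esub> A \<Longrightarrow> p + q \<in> Idl\<^bsub>mpoly_ring V\<^esub> A"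
  using additive_subgroup.a_closed[OF ideal.axioms(1)[OF genideal_ideal[OF A]]] by simp

lemma mpoly_genideal_mult:
  "p \<in> Idl\<^bsub>mpoly_ring V\<^esub> A \<Longrightarrow> q \<in> carrier (mpoly_ring V) \<Longrightarrow> q * p \<in> Idl\<^bsub>mpoly_ring V\<^esub> A"
  using ideal.I_l_closed[OF genideal_ideal[OF A]] by simp

lemma mpoly_genideal_diff:
  assumes "p \<in> Idl\<^bsub>mpoly_ring V\<^esub> A" "q \<in> Idl\<^bsub>mpoly_ring V\<^esub> A"
  shows "p - q \<in> Idl\<^bsub>mpoly_ring V\<^esub> A"
  using mpoly_genideal_add[OF assms(1) mpoly_genideal_mult[OF assms(2), of "- 1"]]
    mpoly_carrier_uminus[OF one_closed] by simp

lemma mpoly_genideal_sum: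
  "(\<And>i. i \<in> B \<Longrightarrow> g i \<in> Idl\<^bsub>mpoly_ring V\<^esub> A) \<Longrightarrow> sum g B \<in> Idl\<^bsub>mpoly_ring V\<^esub> A"
  by (induction B rule: infinite_finite_induct) (auto intro: mpoly_genideal_0 mpoly_genideal_add)

end

text \<open>The combinations form an ideal containing each generator. Coefficients are indexed by
  position so that syzygies can be rewritten entry by entry.\<close>

lemma mpoly_genideal_list:
  fixes fs :: "('v, 'k::comm_ring_1) mpoly list"
  assumes fs: "set fs \<subseteq> carrier (mpoly_ring V)"
  shows "Idl\<^bsub>mpoly_ring V\<^esub> (set fs) =
    {\<Sum>i<length fs. a i * fs ! i | a. \<forall>i. a i \<in> carrier (mpoly_ring V)}" (is "_ = ?L")
proof
  show "Idl\<^bsub>mpoly_ring V\<^esub> (set fs) \<subseteq> ?L"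
  proof (rule mpoly_genideal_minimal)
    show "ideal ?L (mpoly_ring V)"
    proof (rule mpoly_idealI)
      show "?L \<subseteq> carrier (mpoly_ring V)"
        using fs by (auto intro!: mpoly_carrier_sum mpoly_carrier_mult)
      show "0 \<in> ?L"
        by (auto intro!: exI[of _ "\<lambda>_. 0"] simp: mpoly_carrier_0)
    next
      fix p q assume "p \<in> ?L" "q \<in> ?L"
      then obtain a b where "p = (\<Sum>i<length fs. a i * fs ! i)" "q = (\<Sum>i<length fs. b i * fs ! i)"
        "\<forall>i. a i \<in> carrier (mpoly_ring V)" "\<forall>i. b i \<in> carrier (mpoly_ring V)" by blast
      thus "p + q \<in> ?L"
        by (intro CollectI exI[of _ "\<lambda>i. a i + b i"])
           (auto simp: distrib_right sum.distrib intro: mpoly_carrier_add)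
    next
      fix p q :: "('v, 'k) mpoly" assume "p \<in> ?L" "q \<in> carrier (mpoly_ring V)"
      then obtain a where "p = (\<Sum>i<length fs. a i * fs ! i)"
        "\<forall>i. a i \<in> carrier (mpoly_ring V)" by blast
      thus "q * p \<in> ?L" using \<open>q \<in> _\<close>
        by (intro CollectI exI[of _ "\<lambda>i. q * a i"])
           (auto simp: sum_distrib_left mult.assoc intro: mpoly_carrier_mult)
    qed
    show "set fs \<subseteq> ?L"
    proof
      fix f assume "f \<in> set fs"
      then obtain j where j: "j < length fs" "f = fs ! j" by (auto simp: in_set_conv_nth)
      have "(\<Sum>i<length fs. (if i = j then 1 else 0) * fs ! i) = f"
        using j by (simp add: if_distrib[of "\<lambda>x. x * _"] cong: if_cong)
      thus "f \<in> ?L"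
        by (intro CollectI exI[of _ "\<lambda>i. if i = j then 1 else 0"])
           (auto simp: mpoly_carrier_iff)
    qed
  qed
  show "?L \<subseteq> Idl\<^bsub>mpoly_ring V\<^esub> (set fs)"
    using fs by (auto intro!: mpoly_genideal_sum mpoly_genideal_mult intro: mpoly_genideal_self)
qed

lemma lookup_single_mult_add:
  "lkp (sgl m c * p) (m + k) = c * lkp (p :: ('v, 'k::comm_ring_1) mpoly) k"
  by (induction p rule: mpoly_induct)
     (auto simp: mult_single lookup_single when_def distrib_left lookup_add)

lemma lookup_single_mult_eq_0:
  assumes "\<And>l. k \<noteq> m + l"
  shows "lkp (sgl m c * (p :: ('v, 'k::comm_ring_1) mpoly)) k = 0"
proof -
  have "k \<notin> kys (sgl m c * p)" using keys_mult[of "sgl m c" p] assms by (auto split: if_splits)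
  thus ?thesis by (simp add: in_keys_iff)
qed

section \<open>Linear syzygies of a regular sequence\<close>

text \<open>A weak form of the fact that the syzygies are generated by the Koszul ones.\<close>

lemma regular_sequence_syzygy:
  fixes fs :: "('v, 'k::comm_ring_1) mpoly list"
  assumes reg: "regular_sequence (mpoly_ring V) fs"
    and a: "\<And>i. i < length fs \<Longrightarrow> a i \<in> carrier (mpoly_ring V)"
    and 0: "(\<Sum>i<length fs. a i * fs ! i) = 0"
    and i: "i < length fs"
  shows "a i \<in> Idl\<^bsub>mpoly_ring V\<^esub> (set fs)"
proof -
  have fs: "set fs \<subseteq> carrier (mpoly_ring V)" using reg by (simp add: regular_sequence_def)
  have tk: "set (take k fs) \<subseteq> carrier (mpoly_ring V)" for k using fs set_take_subset by fast
  \<comment> \<open>Prefix and coefficients are generalized because the induction step passes to a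
    shorter syzygy with new coefficients.\<close>
  have "a i \<in> Idl\<^bsub>mpoly_ring V\<^esub> (set (take k fs))"
    if "k \<le> length fs" "\<And>i. i < k \<Longrightarrow> a i \<in> carrier (mpoly_ring V)"
       "(\<Sum>i<k. a i * fs ! i) = 0" "i < k" for a k i
    using that
  proof (induction k arbitrary: a i)
    case (Suc k)
    let ?J = "Idl\<^bsub>mpoly_ring V\<^esub> (set (take k fs))"
    have k: "k < length fs" and ak: "a k \<in> carrier (mpoly_ring V)" using Suc.prems by auto
    have nth: "fs ! j \<in> carrier (mpoly_ring V)" if "j < length fs" for j
      using fs that nth_mem by blast
    have "0 - (\<Sum>i<k. a i * fs ! i) \<in> ?J"
    proof (intro mpoly_genideal_diff mpoly_genideal_0 mpoly_genideal_sum mpoly_genideal_mult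
        mpoly_genideal_self tk)
      fix j assume "j \<in> {..<k}"
      thus "fs ! j \<in> set (take k fs)" using k by (auto simp: in_set_conv_nth intro!: exI[of _ j])
      show "a j \<in> carrier (mpoly_ring V)" using \<open>j \<in> _\<close> Suc.prems(2) by simp
    qed
    also have "0 - (\<Sum>i<k. a i * fs ! i) = fs ! k * a k"
      using Suc.prems(3) minus_unique[of "\<Sum>i<k. a i * fs ! i" "fs ! k * a k"]
      by (simp add: mult.commute add.commute)
    \<comment> \<open>The last term lies in the ideal of the earlier generators, modulo which
      \<open>fs ! k\<close> is a nonzerodivisor.\<close>
    finally have akJ: "a k \<in> ?J" using reg k ak by (auto simp: regular_sequence_def)
    then obtain b where b: "a k = (\<Sum>i<k. b i * fs ! i)" "\<And>i. b i \<in> carrier (mpoly_ring V)"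
      using k by (auto simp: mpoly_genideal_list[OF tk] min_def)
    \<comment> \<open>Expanding \<open>a k\<close> in the earlier generators absorbs the last term
      of the syzygy into the first \<open>k\<close> coefficients.\<close>
    have "(\<Sum>i<k. (a i + b i * fs ! k) * fs ! i) = (\<Sum>i<k. a i * fs ! i) + (\<Sum>i<k. b i * fs ! i) * fs ! k"
      unfolding sum_distrib_right sum.distrib[symmetric] by (simp add: algebra_simps)
    also have "\<dots> = 0" using Suc.prems(3) by (simp flip: b(1))
    finally have 0: "(\<Sum>i<k. (a i + b i * fs ! k) * fs ! i) = 0" .
    have *: "a j + b j * fs ! k \<in> ?J" if "j < k" for j
    proof (rule Suc.IH[OF _ _ _ that])
      show "a i + b i * fs ! k \<in> carrier (mpoly_ring V)" if "i < k" for i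
        using Suc.prems(2)[of i] b(2) nth[OF k] that by (simp add: mpoly_carrier_add mpoly_carrier_mult)
    qed (use k 0 in auto)
    have le: "?J \<subseteq> Idl\<^bsub>mpoly_ring V\<^esub> (set (take (Suc k) fs))"
      by (intro mpoly_genideal_minimal ring.genideal_ideal cring.axioms(1) mpoly_ring_cring tk subsetI
          mpoly_genideal_self) (use k in \<open>auto simp: take_Suc_conv_app_nth\<close>)
    show ?case
    proof (cases "i = k")
      case True
      thus ?thesis using akJ le by blast
    next
      case False
      hence "i < k" using Suc.prems(4) by simp
      have "b i * fs ! k \<in> Idl\<^bsub>mpoly_ring V\<^esub> (set (take (Suc k) fs))"
        by (intro mpoly_genideal_mult mpoly_genideal_self tk b)
           (use k in \<open>auto simp: take_Suc_conv_app_nth\<close>)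
      from mpoly_genideal_diff[OF tk subsetD[OF le *[OF \<open>i < k\<close>]] this] show ?thesis by simp
    qed
  qed simp
  from this[of "length fs" a i] a 0 i show ?thesis by simp
qed

section \<open>Total degree of monomials and order of polynomials\<close>

definition mono_deg :: "('v \<Rightarrow>\<^sub>0 nat) \<Rightarrow> nat" where
  "mono_deg m = (\<Sum>v\<in>kys m. lkp m v)"

lemma mono_deg_add: "mono_deg (m + n) = mono_deg m + mono_deg n"
proof -
  have "mono_deg x = (\<Sum>v\<in>kys m \<union> kys n. lkp x v)" if "x \<in> {m, n, m + n}" for x
    unfolding mono_deg_def
    by (rule sum.mono_neutral_left) (use that in \<open>auto simp: keys_add_nat in_keys_iff\<close>)
  thus ?thesis by (simp add: lookup_add sum.distrib)
qed

lemma mono_deg_single [simp]: "mono_deg (sgl v n) = n"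
  by (simp add: mono_deg_def)

lemma mono_deg_eq_0: "mono_deg m = 0 \<longleftrightarrow> m = 0"
  by (auto simp: mono_deg_def in_keys_iff intro!: poly_mapping_eqI)

definition order_ge :: "nat \<Rightarrow> ('v, 'k::comm_ring_1) mpoly \<Rightarrow> bool" where
  "order_ge d p \<longleftrightarrow> (\<forall>m\<in>kys p. d \<le> mono_deg m)"

lemma order_ge_0 [simp]: "order_ge d 0" and order_ge_bound_0 [simp]: "order_ge 0 p"
  by (simp_all add: order_ge_def)

lemma order_ge_add: "order_ge d p \<Longrightarrow> order_ge d q \<Longrightarrow> order_ge d (p + q)"
  using keys_add[of p q] by (auto simp: order_ge_def)

lemma order_ge_diff: "order_ge d p \<Longrightarrow> order_ge d q \<Longrightarrow> order_ge d (p - q)"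
  using keys_diff[of p q] by (auto simp: order_ge_def)

lemma order_ge_sum: "(\<And>i. i \<in> A \<Longrightarrow> order_ge d (g i)) \<Longrightarrow> order_ge d (sum g A)"
  by (induction A rule: infinite_finite_induct) (auto intro: order_ge_add)

lemma order_ge_mult: "order_ge d p \<Longrightarrow> order_ge e q \<Longrightarrow> order_ge (d + e) (p * q)"
  using keys_mult[of p q] by (fastforce simp: order_ge_def mono_deg_add intro: add_mono)

lemma order_ge_var: "order_ge 1 (mpoly_var v)"
  by (simp add: order_ge_def mpoly_var_def)

lemma order_ge_1: "lkp p 0 = 0 \<Longrightarrow> order_ge 1 p"
  by (auto simp: order_ge_def in_keys_iff Suc_le_eq mono_deg_eq_0 simp flip: neq0_conv)

text \<open>Polynomials of order at least \<open>d\<close> form an ideal, since multiplication never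
  lowers the order.\<close>

lemma order_ge_genideal:
  fixes A :: "('v, 'k::comm_ring_1) mpoly set"
  assumes "A \<subseteq> carrier (mpoly_ring V)" "\<And>p. p \<in> A \<Longrightarrow> order_ge d p" "p \<in> Idl\<^bsub>mpoly_ring V\<^esub> A"
  shows "order_ge d p"
proof -
  let ?J = "{p \<in> carrier (mpoly_ring V). order_ge d p} :: ('v, 'k) mpoly set"
  have "ideal ?J (mpoly_ring V)"
    using order_ge_mult[of 0]
    by (intro mpoly_idealI) (auto intro: mpoly_carrier_intros order_ge_add)
  thus ?thesis using mpoly_genideal_minimal[of ?J V A] assms by blast
qed

text \<open>Isolates one constant term: in a sum of variables times polynomials, the linear
  coefficient at \<open>v\<close> comes only from the summand of \<open>v\<close>.\<close>

lemma lookup_var_mult_single: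
  "lkp (mpoly_var w * (p :: ('v, 'k::comm_ring_1) mpoly)) (sgl v 1) = (if v = w then lkp p 0 else 0)"
proof (cases "v = w")
  case True
  thus ?thesis using lookup_single_mult_add[of "sgl w 1" 1 p 0] by (simp add: mpoly_var_def)
next
  case False
  have "sgl v 1 \<noteq> sgl w 1 + l" for l :: "'v \<Rightarrow>\<^sub>0 nat"
  proof
    assume "sgl v (1::nat) = sgl w 1 + l"
    hence "lkp (sgl v (1::nat)) w = lkp (sgl w 1 + l) w" by simp
    thus False using False by (simp add: lookup_add lookup_single)
  qed
  thus ?thesis using False unfolding mpoly_var_def by (simp add: lookup_single_mult_eq_0)
qed

text \<open>
  Writing \<open>H v = \<Sum>\<^sub>k A\<^sub>v\<^sub>k f\<^sub>k\<close>, the coefficients \<open>\<Sum>\<^sub>v x\<^sub>v A\<^sub>v\<^sub>k\<close> of the syzygy lie in the ideal and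
  hence have no linear part; so \<open>A\<^sub>v\<^sub>k\<close> has no constant term and \<open>H v\<close> has order at least \<open>3\<close>.
\<close>

lemma regular_sequence_no_linear_syzygy:
  fixes fs :: "('v, 'k::comm_ring_1) mpoly list"
  assumes reg: "regular_sequence (mpoly_ring V) fs"
    and ord: "\<And>p. p \<in> Idl\<^bsub>mpoly_ring V\<^esub> (set fs) \<Longrightarrow> order_ge 2 p"
    and W: "finite W" "W \<subseteq> V"
    and H: "\<And>v. v \<in> W \<Longrightarrow> H v \<in> Idl\<^bsub>mpoly_ring V\<^esub> (set fs)"
    and syz: "(\<Sum>v\<in>W. mpoly_var v * H v) = 0"
    and v: "v \<in> W"
  shows "order_ge 3 (H v)"
proof -
  have fs: "set fs \<subseteq> carrier (mpoly_ring V)" using reg by (simp add: regular_sequence_def)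
  have "\<exists>a. H v = (\<Sum>i<length fs. a i * fs ! i) \<and> (\<forall>i. a i \<in> carrier (mpoly_ring V))"
    if "v \<in> W" for v
    using H[OF that] unfolding mpoly_genideal_list[OF fs] by blast
  then obtain A where A: "\<And>v. v \<in> W \<Longrightarrow> H v = (\<Sum>i<length fs. A v i * fs ! i)"
    and Ac: "\<And>v i. v \<in> W \<Longrightarrow> A v i \<in> carrier (mpoly_ring V)" by metis
  \<comment> \<open>Swapping the sums turns the linear syzygy of the \<open>H v\<close> into a
    syzygy of \<open>fs\<close>.\<close>
  have "(\<Sum>i<length fs. (\<Sum>v\<in>W. mpoly_var v * A v i) * fs ! i) = (\<Sum>v\<in>W. mpoly_var v * H v)"
    by (simp add: A sum_distrib_left sum_distrib_right mult.assoc sum.swap[of _ W])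
  hence "(\<Sum>i<length fs. (\<Sum>v\<in>W. mpoly_var v * A v i) * fs ! i) = 0" by (simp add: syz)
  from regular_sequence_syzygy[OF reg _ this] W Ac
  have I: "(\<Sum>v\<in>W. mpoly_var v * A v i) \<in> Idl\<^bsub>mpoly_ring V\<^esub> (set fs)" if "i < length fs" for i
    using that by (auto intro!: mpoly_carrier_intros)
  have "lkp (A v i) 0 = 0" if "i < length fs" for i
  proof -
    have "sgl v 1 \<notin> kys (\<Sum>w\<in>W. mpoly_var w * A w i)"
      using ord[OF I[OF that]] by (auto simp: order_ge_def dest!: bspec)
    hence "0 = (\<Sum>w\<in>W. lkp (mpoly_var w * A w i) (sgl v 1))" by (simp add: in_keys_iff lookup_sum)
    also have "\<dots> = lkp (A v i) 0" using v W(1) unfolding lookup_var_mult_single by simp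
    finally show ?thesis ..
  qed
  hence "order_ge 3 (A v i * fs ! i)" if "i < length fs" for i
    using order_ge_mult[OF order_ge_1 ord[OF mpoly_genideal_self[OF fs]], of "A v i" "fs ! i"] that
    by (simp add: numeral_3_eq_3)
  thus ?thesis unfolding A[OF v] by (intro order_ge_sum) simp
qed

section \<open>A sufficient condition for regularity\<close>

text \<open>Division by the monomial \<open>u\<close>: adding \<open>u\<close> to the index drops the non-multiples of \<open>u\<close>.\<close>

definition mono_quot :: "('v \<Rightarrow>\<^sub>0 nat) \<Rightarrow> ('v, 'k::comm_ring_1) mpoly \<Rightarrow> ('v, 'k) mpoly" where
  "mono_quot u p = Poly_Mapping.map_key (\<lambda>m. m + u) p"

lemma lookup_mono_quot: "lkp (mono_quot u p) m = lkp p (m + u)"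
  by (simp add: mono_quot_def Poly_Mapping.map_key.rep_eq inj_on_def)

lemma mono_quot_0 [simp]: "mono_quot u 0 = 0"
  by (rule poly_mapping_eqI) (simp add: lookup_mono_quot)

lemma mono_quot_add: "mono_quot u (p + q) = mono_quot u p + mono_quot u q"
  by (rule poly_mapping_eqI) (simp add: lookup_mono_quot lookup_add)

lemma mono_quot_diff: "mono_quot u (p - q) = mono_quot u p - mono_quot u q"
  by (rule poly_mapping_eqI) (simp add: lookup_mono_quot lookup_minus)

lemma mono_quot_sum: "mono_quot u (sum g A) = (\<Sum>i\<in>A. mono_quot u (g i))"
  by (induction A rule: infinite_finite_induct) (simp_all add: mono_quot_add)

lemma mono_quot_mult_self: "mono_quot u (sgl u 1 * p) = p"
  by (rule poly_mapping_eqI)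
     (simp add: lookup_mono_quot add.commute[of _ u] lookup_single_mult_add)

lemma mono_quot_carrier:
  assumes "p \<in> carrier (mpoly_ring V)"
  shows "mono_quot u p \<in> carrier (mpoly_ring V)"
  unfolding mpoly_carrier_iff
proof
  fix m assume "m \<in> kys (mono_quot u p)"
  hence "m + u \<in> kys p" by (simp add: in_keys_iff lookup_mono_quot)
  hence "kys (m + u) \<subseteq> V" using assms unfolding mpoly_carrier_iff by blast
  thus "kys m \<subseteq> V" by (simp add: keys_add_nat)
qed

definition avoids :: "'v set \<Rightarrow> ('v, 'k::comm_ring_1) mpoly \<Rightarrow> bool" where
  "avoids U p \<longleftrightarrow> (\<forall>m\<in>kys p. kys m \<inter> U = {})"

text \<open>Multiplying by a monomial coprime to \<open>u\<close> does not affect divisibility by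
  \<open>u\<close>, so division by \<open>u\<close> is linear over polynomials avoiding its
  variables.\<close>

lemma mono_quot_mult_avoids:
  fixes p q :: "('v, 'k::comm_ring_1) mpoly"
  assumes "avoids (kys u) q"
  shows "mono_quot u (q * p) = q * mono_quot u p"
proof -
  have *: "mono_quot u (sgl m c * p) = sgl m c * mono_quot u p" if m: "kys m \<inter> kys u = {}" for m c
  proof (rule poly_mapping_eqI)
    fix k
    show "lkp (mono_quot u (sgl m c * p)) k = lkp (sgl m c * mono_quot u p) k"
    proof (cases "\<exists>l. k = m + l")
      case True
      then obtain l where "k = m + l" by blast
      thus ?thesis by (simp add: lookup_mono_quot add.assoc lookup_single_mult_add)
    next
      case False
      \<comment> \<open>If \<open>m\<close> divided \<open>k + u\<close>, it would divide
        \<open>k\<close>, being coprime to \<open>u\<close>. Hence both coefficients vanish.\<close>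
      have "k + u \<noteq> m + l" for l
      proof
        assume eq: "k + u = m + l"
        have "lkp m x \<le> lkp k x" for x
        proof (cases "x \<in> kys m")
          case True
          hence "lkp u x = 0" using m by (auto simp: in_keys_iff)
          moreover have "lkp (k + u) x = lkp (m + l) x" using eq by simp
          ultimately show ?thesis by (simp add: lookup_add)
        qed (simp add: in_keys_iff)
        hence "k = m + (k - m)" by (intro poly_mapping_eqI) (simp add: lookup_add lookup_minus)
        thus False using False by blast
      qed
      thus ?thesis using False by (simp add: lookup_mono_quot lookup_single_mult_eq_0)
    qed
  qed
  have "mono_quot u ((\<Sum>m\<in>kys q. sgl m (lkp q m)) * p) = (\<Sum>m\<in>kys q. sgl m (lkp q m)) * mono_quot u p"
    unfolding sum_distrib_right mono_quot_sum
    using assms by (intro sum.cong refl *) (auto simp: avoids_def)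
  thus ?thesis unfolding mpoly_expansion[of q, symmetric] .
qed

text \<open>Each division lowers the exponent of a fixed variable of \<open>u\<close>, and the
  exponents occurring in \<open>p\<close> are bounded.\<close>

lemma mono_quot_funpow_eq_0:
  assumes "u \<noteq> 0"
  shows "\<exists>s. (mono_quot u ^^ s) p = 0"
proof -
  from assms obtain a where a: "a \<in> kys u" by (auto simp flip: keys_eq_empty)
  have look: "lkp ((mono_quot u ^^ s) p) m = lkp p (m + (\<Sum>i<s. u))" for s m
    by (induction s arbitrary: m) (simp_all add: lookup_mono_quot add.assoc add.commute[of u])
  \<comment> \<open>The sum bounds the exponent of \<open>a\<close> in every monomial of
    \<open>p\<close>; \<open>Suc\<close> makes the bound strict.\<close>
  define s where "s = Suc (\<Sum>l\<in>kys p. lkp l a)"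
  have "m + (\<Sum>i<s. u) \<notin> kys p" for m
  proof
    assume m: "m + (\<Sum>i<s. u) \<in> kys p"
    have "s \<le> lkp (m + (\<Sum>i<s. u)) a"
      using a by (simp add: lookup_add lookup_sum in_keys_iff trans_le_add2)
    also have "\<dots> \<le> (\<Sum>l\<in>kys p. lkp l a)" by (rule member_le_sum[OF m]) auto
    finally show False by (simp add: s_def)
  qed
  hence "(mono_quot u ^^ s) p = 0" by (intro poly_mapping_eqI) (simp add: look in_keys_iff)
  thus ?thesis ..
qed

lemma avoids_mult: "avoids U p \<Longrightarrow> avoids U q \<Longrightarrow> avoids U (p * q)"
  using keys_mult[of p q] by (fastforce simp: avoids_def keys_add_nat)

lemma avoids_diff: "avoids U p \<Longrightarrow> avoids U q \<Longrightarrow> avoids U (p - q)"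
  using keys_diff[of p q] by (auto simp: avoids_def)

lemma avoids_var: "v \<notin> U \<Longrightarrow> avoids U (mpoly_var v)"
  by (simp add: avoids_def mpoly_var_def)

text \<open>
  Modulo the ideal, \<open>u g = q g\<close> with \<open>q\<close> and the generators free of the variables of \<open>u\<close>.
  Division \<open>D\<close> by \<open>u\<close> commutes with them, so \<open>g = q D g = q\<^sup>2 D\<^sup>2 g = \<dots>\<close>, and \<open>D\<close> is nilpotent on \<open>g\<close>.
\<close>

lemma mono_minus_avoids_nonzerodivisor:
  fixes fs :: "('v, 'k::comm_ring_1) mpoly list"
  assumes fs: "set fs \<subseteq> carrier (mpoly_ring V)" "\<And>f. f \<in> set fs \<Longrightarrow> avoids (kys u) f"
    and u: "u \<noteq> 0" and q: "q \<in> carrier (mpoly_ring V)" "avoids (kys u) q"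
    and g: "g \<in> carrier (mpoly_ring V)" "(sgl u 1 - q) * g \<in> Idl\<^bsub>mpoly_ring V\<^esub> (set fs)"
  shows "g \<in> Idl\<^bsub>mpoly_ring V\<^esub> (set fs)"
proof -
  let ?J = "Idl\<^bsub>mpoly_ring V\<^esub> (set fs)" and ?D = "mono_quot u"
  \<comment> \<open>Division acts only on the coefficients of a combination, as the generators avoid
    the variables of \<open>u\<close>.\<close>
  have D: "?D p \<in> ?J" if pJ: "p \<in> ?J" for p
  proof -
    from pJ obtain a where a: "p = (\<Sum>i<length fs. a i * fs ! i)"
      "\<And>i. a i \<in> carrier (mpoly_ring V)" unfolding mpoly_genideal_list[OF fs(1)] by blast
    have "?D p = (\<Sum>i<length fs. ?D (a i) * fs ! i)"
      unfolding a(1) mono_quot_sum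
      by (intro sum.cong refl) (simp add: mult.commute[of _ "fs ! _"] mono_quot_mult_avoids fs(2))
    also have "\<dots> \<in> ?J"
      by (intro mpoly_genideal_sum mpoly_genideal_mult mpoly_genideal_self mono_quot_carrier fs a) auto
    finally show ?thesis .
  qed
  have D_pow: "(?D ^^ s) p \<in> ?J" if "p \<in> ?J" for s p
    by (induction s) (use D that in auto)
  have "?D ((sgl u 1 - q) * g) = g - q * ?D g"
    by (simp add: left_diff_distrib mono_quot_diff mono_quot_mult_self mono_quot_mult_avoids q(2))
  hence step: "g - q * ?D g \<in> ?J" using D[OF g(2)] by simp
  have D_pow_step: "(?D ^^ s) (g - q * ?D g) = (?D ^^ s) g - q * (?D ^^ Suc s) g" for s
    by (induction s) (simp_all add: mono_quot_diff mono_quot_mult_avoids q(2))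
  have q_pow: "q ^ s \<in> carrier (mpoly_ring V)" for s
    by (induction s) (auto simp: mpoly_carrier_iff[of 1] intro: mpoly_carrier_mult q(1))
  \<comment> \<open>Telescoping: consecutive expressions differ by \<open>q ^ s\<close> times the
    \<open>s\<close>-fold division of the element in \<open>step\<close>.\<close>
  have "g - q ^ s * (?D ^^ s) g \<in> ?J" for s
  proof (induction s)
    case 0
    show ?case using fs(1) by (simp add: mpoly_genideal_0)
  next
    case (Suc s)
    have "q ^ s * ((?D ^^ s) g - q * (?D ^^ Suc s) g) \<in> ?J"
      unfolding D_pow_step[symmetric] by (intro mpoly_genideal_mult D_pow step q_pow fs(1))
    from mpoly_genideal_add[OF fs(1) Suc this] show ?case
      by (simp add: algebra_simps)
  qed
  moreover obtain s where "(?D ^^ s) g = 0" using mono_quot_funpow_eq_0[OF u] by blast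
  ultimately show ?thesis by (metis diff_zero mult_zero_right)
qed

section \<open>Posets in which every element has at most one incomparable partner\<close>

definition incomparable :: "'a rel \<Rightarrow> 'a \<Rightarrow> 'a \<Rightarrow> bool" where
  "incomparable r x y \<longleftrightarrow> (x, y) \<notin> r \<and> (y, x) \<notin> r"

lemma incomparable_sym: "incomparable r x y \<longleftrightarrow> incomparable r y x"
  by (auto simp: incomparable_def)

definition partners_unique :: "'a set \<Rightarrow> 'a rel \<Rightarrow> bool" where
  "partners_unique P r \<longleftrightarrow>
     (\<forall>x\<in>P. \<forall>y\<in>P. \<forall>z\<in>P. incomparable r x y \<longrightarrow> incomparable r x z \<longrightarrow> y = z)"

lemma partners_uniqueD:
  "partners_unique P r \<Longrightarrow> incomparable r x y \<Longrightarrow> incomparable r x z \<Longrightarrow>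
     x \<in> P \<Longrightarrow> y \<in> P \<Longrightarrow> z \<in> P \<Longrightarrow> y = z"
  by (auto simp: partners_unique_def)

text \<open>\<open>(x + 1) div 2\<close> numbers the antichain containing \<open>x\<close>, counting
  from 1, so distinct elements are ordered exactly as these numbers.\<close>

lemma antichain_pairs_sum_eq:
  "fst (antichain_pairs_sum n) = {1..2 * n}"
  "snd (antichain_pairs_sum n) =
     {(x, y). x \<in> {1..2 * n} \<and> y \<in> {1..2 * n} \<and> (x = y \<or> (x + 1) div 2 < (y + 1) div 2)}"
proof (induction n)
  case (Suc n)
  { case 1 show ?case using Suc.IH(1) by (auto simp: ordinal_sum_def antichain_poset_def) }
  { case 2 show ?case
      unfolding antichain_pairs_sum.simps ordinal_sum_def antichain_poset_def snd_conv fst_conv Suc.IH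
      by (auto simp: Id_on_def) presburger+ }
qed auto

lemma antichain_pairs_sum_partners_unique:
  "partners_unique (fst (antichain_pairs_sum n)) (snd (antichain_pairs_sum n))"
  unfolding partners_unique_def incomparable_def antichain_pairs_sum_eq
  by auto

text \<open>Elements having an incomparable partner lie outside
  \<open>comparable_to_all P r\<close>, so uniqueness transfers along the isomorphism.\<close>

lemma partners_unique_if_isomorphic:
  assumes "poset_isomorphic (induced_subposet r (P - comparable_to_all P r)) (antichain_pairs_sum n)"
  shows "partners_unique P r"
  unfolding partners_unique_def
proof (intro ballI impI)
  fix x y z assume xyz: "x \<in> P" "y \<in> P" "z \<in> P" "incomparable r x y" "incomparable r x z"
  let ?Q = "P - comparable_to_all P r" and ?B = "antichain_pairs_sum n"
  obtain f where f: "bij_betw f ?Q (fst ?B)"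
    "\<forall>x\<in>?Q. \<forall>y\<in>?Q. (x, y) \<in> r \<longleftrightarrow> (f x, f y) \<in> snd ?B"
    using assms by (auto simp: poset_isomorphic_def induced_subposet_def)
  have Q: "x \<in> ?Q" "y \<in> ?Q" "z \<in> ?Q"
    using xyz by (auto simp: comparable_to_all_def incomparable_def)
  hence "f y = f z"
    using f xyz by (intro partners_uniqueD[OF antichain_pairs_sum_partners_unique, of _ "f x"])
      (auto simp: incomparable_def bij_betw_def)
  thus "y = z" using f(1) Q by (auto simp: bij_betw_def inj_on_def)
qed

text \<open>A maximal element of \<open>Q\<close> and its partner form the top antichain: all other
  elements lie below both, and removing the pair allows induction on the size of
  \<open>Q\<close>.\<close>

lemma isomorphic_antichain_pairs_sum:
  assumes "finite Q" "Q \<subseteq> P" "partial_order_on P r" "partners_unique P r"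
    and "\<And>x. x \<in> Q \<Longrightarrow> \<exists>y\<in>Q. incomparable r x y"
  shows "\<exists>n. poset_isomorphic (induced_subposet r Q) (antichain_pairs_sum n)"
  using assms(1,2,5)
proof (induction "card Q" arbitrary: Q rule: less_induct)
  case less
  have r: "r \<subseteq> P \<times> P" "\<And>x. x \<in> P \<Longrightarrow> (x, x) \<in> r" "trans r" "antisym r"
    using assms(3) by (auto simp: partial_order_on_def preorder_on_def refl_on_def)
  show ?case
  proof (cases "Q = {}")
    case True
    thus ?thesis
      by (intro exI[of _ 0]) (simp add: poset_isomorphic_def induced_subposet_def bij_betw_def)
  next
    case False
    let ?less = "\<lambda>x y. (x, y) \<in> r \<and> x \<noteq> y"
    have "asymp_on Q ?less"
      by (rule asymp_onI) (use antisymD[OF r(4)] in blast)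
    moreover have "transp_on Q ?less"
      by (rule transp_onI) (use transD[OF r(3)] antisymD[OF r(4)] in blast)
    ultimately obtain p where p: "p \<in> Q" "\<And>y. y \<in> Q \<Longrightarrow> (p, y) \<in> r \<Longrightarrow> y = p"
      using Finite_Set.bex_max_element[OF less.prems(1) _ _ False, of ?less] by auto
    obtain q where q: "q \<in> Q" "incomparable r p q" using less.prems(3) p(1) by blast
    have uniq: "y = z" if "incomparable r x y" "incomparable r x z" "x \<in> Q" "y \<in> Q" "z \<in> Q" for x y z
      using partners_uniqueD[OF assms(4) that(1,2)] that less.prems(2) by blast
    \<comment> \<open>Uniqueness makes \<open>s\<close> comparable to \<open>p\<close>, and
      maximality of \<open>p\<close> leaves only one direction.\<close>
    have below_p: "(s, p) \<in> r" if "s \<in> Q" "s \<noteq> q" for s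
    proof (rule ccontr)
      assume "(s, p) \<notin> r"
      hence "incomparable r p s \<or> (p, s) \<in> r" by (auto simp: incomparable_def)
      thus False using uniq[OF q(2), of s] p(2)[of s] p(1) q(1) that \<open>(s, p) \<notin> r\<close> r(2) less.prems(2) by blast
    qed
    \<comment> \<open>Maximality of \<open>q\<close> is not given: an \<open>s\<close> above
      \<open>q\<close> would lie below \<open>p\<close>, placing \<open>q\<close> below
      \<open>p\<close>.\<close>
    have below_q: "(s, q) \<in> r" if "s \<in> Q" "s \<noteq> p" for s
    proof (rule ccontr)
      assume s: "(s, q) \<notin> r"
      hence "s \<noteq> q" using r(2) q(1) less.prems(2) by blast
      have "incomparable r q s \<or> (q, s) \<in> r" using s by (auto simp: incomparable_def)
      thus False
      proof
        assume "incomparable r q s"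
        thus False using uniq[of q s p] q p(1) that by (auto simp: incomparable_sym)
      next
        assume "(q, s) \<in> r"
        hence "(q, p) \<in> r" using below_p[OF that(1) \<open>s \<noteq> q\<close>] r(3) by (blast dest: transD)
        thus False using q(2) by (auto simp: incomparable_def)
      qed
    qed
    have above: "(p, s) \<notin> r" "(q, s) \<notin> r" if "s \<in> Q" "s \<noteq> p" "s \<noteq> q" for s
      using below_p[of s] below_q[of s] that r(4) by (blast dest: antisymD)+
    have pq: "p \<noteq> q" using q r(2) less.prems(2) by (auto simp: incomparable_def)
    let ?Q = "Q - {p, q}"
    \<comment> \<open>The partner of \<open>x\<close> is neither \<open>p\<close> nor
      \<open>q\<close>, because \<open>x\<close> lies below both.\<close>
    have "\<exists>y\<in>?Q. incomparable r x y" if "x \<in> ?Q" for x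
      using less.prems(3)[of x] that below_p[of x] below_q[of x] by (auto simp: incomparable_def)
    moreover have "card ?Q < card Q"
      using less.prems(1) p(1) by (intro psubset_card_mono) auto
    ultimately obtain n where "poset_isomorphic (induced_subposet r ?Q) (antichain_pairs_sum n)"
      using less.hyps[of ?Q] less.prems(1,2) by auto
    then obtain f where f: "bij_betw f ?Q {1..2 * n}"
      "\<And>x y. x \<in> ?Q \<Longrightarrow> y \<in> ?Q \<Longrightarrow> (x, y) \<in> r \<longleftrightarrow> (f x, f y) \<in> snd (antichain_pairs_sum n)"
      by (auto simp: poset_isomorphic_def induced_subposet_def antichain_pairs_sum_eq(1))
    define h where "h = f(p := 2 * n + 1, q := 2 * n + 2)"
    have h: "h p = 2 * n + 1" "h q = 2 * n + 2" "\<And>x. x \<in> ?Q \<Longrightarrow> h x = f x"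
      using pq by (auto simp: h_def)
    have fim: "f x \<in> {1..2 * n}" if "x \<in> ?Q" for x using f(1) that by (auto simp: bij_betw_def)
    have "bij_betw h (?Q \<union> {p, q}) ({1..2 * n} \<union> {2 * n + 1, 2 * n + 2})"
    proof (rule bij_betw_combine)
      show "bij_betw h ?Q {1..2 * n}" using f(1) by (subst bij_betw_cong[OF h(3)])
      show "bij_betw h {p, q} {2 * n + 1, 2 * n + 2}" using h pq by (auto simp: bij_betw_def)
    qed auto
    moreover have "?Q \<union> {p, q} = Q" using p(1) q(1) by auto
    moreover have "{1..2 * n} \<union> {2 * n + 1, 2 * n + 2} = {1..2 * Suc n}" by auto
    ultimately have "bij_betw h Q (fst (antichain_pairs_sum (Suc n)))"
      by (simp only: antichain_pairs_sum_eq(1))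
    moreover have "(x, y) \<in> r \<longleftrightarrow> (h x, h y) \<in> snd (antichain_pairs_sum (Suc n))"
      if "x \<in> Q" "y \<in> Q" for x y
    proof -
      have S: "(h x, h y) \<in> snd (antichain_pairs_sum (Suc n)) \<longleftrightarrow>
          (h x, h y) \<in> snd (antichain_pairs_sum n) \<or> (h x \<in> {1..2 * n} \<and> h y \<in> {2 * n + 1, 2 * n + 2})
          \<or> (h x = h y \<and> h x \<in> {2 * n + 1, 2 * n + 2})"
        by (auto simp: ordinal_sum_def antichain_poset_def antichain_pairs_sum_eq(1))
      have N: "(a, b) \<notin> snd (antichain_pairs_sum n)" if "a > 2 * n \<or> b > 2 * n" for a b
        using that by (auto simp: antichain_pairs_sum_eq(2))
      have refl: "(p, p) \<in> r" "(q, q) \<in> r" using r(2) p(1) q(1) less.prems(2) by auto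
      have inc: "(p, q) \<notin> r" "(q, p) \<notin> r" using q(2) by (auto simp: incomparable_def)
      consider "x \<in> ?Q" "y \<in> ?Q" | "x \<in> ?Q" "y \<in> {p, q}" | "x \<in> {p, q}" "y \<in> ?Q"
        | "x \<in> {p, q}" "y \<in> {p, q}" using \<open>x \<in> Q\<close> \<open>y \<in> Q\<close> by blast
      thus ?thesis
      proof cases
        case 1
        thus ?thesis unfolding S using f(2)[of x y] fim[of x] fim[of y] by (auto simp: h)
      next
        case 2
        thus ?thesis unfolding S using fim[of x] below_p[of x] below_q[of x] by (auto simp: h)
      next
        case 3
        thus ?thesis unfolding S using fim[of y] above[of y] N by (auto simp: h)
      next
        case 4
        thus ?thesis unfolding S using refl inc N by (auto simp: h)
      qed
    qed
    ultimately show ?thesis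
      by (intro exI[of _ "Suc n"]) (auto simp: poset_isomorphic_def induced_subposet_def)
  qed
qed

lemma partners_unique_iff:
  assumes "finite P" "partial_order_on P r"
  shows "partners_unique P r \<longleftrightarrow> linear_order_on P r \<or>
    (\<exists>n\<ge>1. poset_isomorphic (induced_subposet r (P - comparable_to_all P r)) (antichain_pairs_sum n))"
    (is "_ \<longleftrightarrow> _ \<or> (\<exists>n\<ge>1. ?iso n)")
proof
  let ?Q = "P - comparable_to_all P r"
  assume *: "partners_unique P r"
  have "\<exists>y\<in>?Q. incomparable r x y" if "x \<in> ?Q" for x
    using that by (auto simp: comparable_to_all_def incomparable_def)
  then obtain n where n: "?iso n"
    using isomorphic_antichain_pairs_sum[of ?Q P r] assms * by auto
  show "linear_order_on P r \<or> (\<exists>n\<ge>1. ?iso n)"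
  \<comment> \<open>For \<open>n = 0\<close> every element is comparable to all others, so
    \<open>P\<close> is a chain.\<close>
  proof (cases "n = 0")
    case True
    hence "?Q = {}" using n by (auto simp: poset_isomorphic_def induced_subposet_def bij_betw_def)
    hence "total_on P r" by (auto simp: total_on_def comparable_to_all_def)
    thus ?thesis using assms(2) by (simp add: linear_order_on_def)
  qed (use n in force)
next
  assume "linear_order_on P r \<or> (\<exists>n\<ge>1. ?iso n)"
  thus "partners_unique P r"
  proof
    assume "linear_order_on P r"
    hence "\<not> incomparable r x y" if "x \<in> P" "y \<in> P" for x y
      using that by (cases "x = y")
        (auto simp: linear_order_on_def partial_order_on_def preorder_on_def refl_on_def
          total_on_def incomparable_def)
    thus ?thesis by (auto simp: partners_unique_def)
  qed (use partners_unique_if_isomorphic in blast)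
qed

section \<open>Pairs of incomparable order ideals\<close>

lemma order_idealsD:
  "\<alpha> \<in> order_ideals P r \<Longrightarrow> x \<in> \<alpha> \<Longrightarrow> (y, x) \<in> r \<Longrightarrow> y \<in> \<alpha>"
  "\<alpha> \<in> order_ideals P r \<Longrightarrow> \<alpha> \<subseteq> P"
  by (auto simp: order_ideals_def)

lemma order_ideals_Int: "\<alpha> \<in> order_ideals P r \<Longrightarrow> \<beta> \<in> order_ideals P r \<Longrightarrow> \<alpha> \<inter> \<beta> \<in> order_ideals P r"
  and order_ideals_Un: "\<alpha> \<in> order_ideals P r \<Longrightarrow> \<beta> \<in> order_ideals P r \<Longrightarrow> \<alpha> \<union> \<beta> \<in> order_ideals P r"
  by (auto simp: order_ideals_def)

text \<open>Down-closure makes every element of one difference incomparable to every element of the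
  other; uniqueness then leaves one element in each.\<close>

lemma partners_unique_order_ideal_Diff:
  assumes "partners_unique P r" "\<alpha> \<in> order_ideals P r" "\<beta> \<in> order_ideals P r"
    and "\<not> \<alpha> \<subseteq> \<beta>" "\<not> \<beta> \<subseteq> \<alpha>"
  obtains p q where "\<alpha> - \<beta> = {p}" "\<beta> - \<alpha> = {q}" "incomparable r p q"
proof -
  have inc: "incomparable r x y" if "x \<in> \<alpha> - \<beta>" "y \<in> \<beta> - \<alpha>" for x y
    using that order_idealsD(1)[OF assms(2)] order_idealsD(1)[OF assms(3)]
    by (auto simp: incomparable_def)
  obtain p q where pq: "p \<in> \<alpha> - \<beta>" "q \<in> \<beta> - \<alpha>" using assms(4,5) by blast
  have P: "\<alpha> \<subseteq> P" "\<beta> \<subseteq> P" using assms(2,3) order_idealsD(2) by auto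
  have "x = p" if "x \<in> \<alpha> - \<beta>" for x
    using partners_uniqueD[OF assms(1), of q x p] inc[OF that pq(2)] inc[OF pq] P pq that
    by (auto simp: incomparable_sym)
  moreover have "y = q" if "y \<in> \<beta> - \<alpha>" for y
    using partners_uniqueD[OF assms(1) inc[OF pq(1) that] inc[OF pq]] P pq that by auto
  ultimately show thesis using pq inc[OF pq] by (intro that[of p q]) blast+
qed

text \<open>Each partner of \<open>\<alpha>\<close> arises by exchanging one element,
  \<open>p\<close> for \<open>q\<close> or \<open>p'\<close> for \<open>q'\<close>. If
  \<open>p\<close> and \<open>p'\<close> differ, they are comparable to each other and lie below
  \<open>q'\<close> and \<open>q\<close> respectively, which makes one exchanged pair
  comparable.\<close>

lemma partners_unique_order_ideals:
  assumes r: "trans r" and pu: "partners_unique P r"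
    and \<alpha>: "\<alpha> \<in> order_ideals P r" and \<beta>: "\<beta> \<in> order_ideals P r" and \<delta>: "\<delta> \<in> order_ideals P r"
    and "\<not> \<alpha> \<subseteq> \<beta>" "\<not> \<beta> \<subseteq> \<alpha>" "\<not> \<alpha> \<subseteq> \<delta>" "\<not> \<delta> \<subseteq> \<alpha>"
  shows "\<beta> = \<delta>"
proof -
  obtain p q where pq: "\<alpha> - \<beta> = {p}" "\<beta> - \<alpha> = {q}" "incomparable r p q"
    using partners_unique_order_ideal_Diff[OF pu \<alpha> \<beta>] assms by blast
  obtain p' q' where pq': "\<alpha> - \<delta> = {p'}" "\<delta> - \<alpha> = {q'}" "incomparable r p' q'"
    using partners_unique_order_ideal_Diff[OF pu \<alpha> \<delta>] assms by blast
  have mem: "p \<in> \<alpha>" "q \<in> \<beta>" "q \<notin> \<alpha>" "p' \<in> \<alpha>" "q' \<in> \<delta>" "q' \<notin> \<alpha>"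
    using pq(1,2) pq'(1,2) by auto
  hence P: "p \<in> P" "q \<in> P" "p' \<in> P" "q' \<in> P"
    using order_idealsD(2)[OF \<alpha>] order_idealsD(2)[OF \<beta>] order_idealsD(2)[OF \<delta>] by auto
  note uniq = partners_uniqueD[OF pu]
  show ?thesis
  proof (cases "p = p'")
    case True
    hence "q = q'" using uniq[of p q q'] pq pq' P by simp
    thus ?thesis using True pq pq' by blast
  next
    case False
    have "p' \<noteq> q" using mem by auto
    have "(q', p) \<notin> r" "(q, p') \<notin> r" using order_idealsD(1)[OF \<alpha>] mem by auto
    \<comment> \<open>Otherwise \<open>q' = q\<close>, and then \<open>p\<close> and
      \<open>p'\<close> would be two partners of \<open>q\<close>.\<close>
    moreover have "\<not> incomparable r p q'"
      using uniq[of p q q'] uniq[of q p p'] pq pq' P False by (auto simp: incomparable_sym)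
    moreover have "\<not> incomparable r p' q"
      using uniq[of q p p'] pq P False by (auto simp: incomparable_sym)
    ultimately have "(p, q') \<in> r" "(p', q) \<in> r" by (auto simp: incomparable_def)
    moreover have "\<not> incomparable r p p'" using uniq[of p q p'] pq P \<open>p' \<noteq> q\<close> by auto
    ultimately have "(p, q) \<in> r \<or> (p', q') \<in> r"
      using transD[OF r, of p p' q] transD[OF r, of p' p q'] by (auto simp: incomparable_def)
    thus ?thesis using pq(3) pq'(3) by (auto simp: incomparable_def)
  qed
qed

text \<open>An ideal incomparable to the meet is incomparable to \<open>\<alpha>\<close> or
  \<open>\<beta>\<close>, hence equals the other, which contains the meet; dually for the
  join.\<close>

lemma partners_unique_Int_Un:
  assumes "trans r" "partners_unique P r"
    and "\<alpha> \<in> order_ideals P r" "\<beta> \<in> order_ideals P r" "\<delta> \<in> order_ideals P r"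
    and "\<not> \<alpha> \<subseteq> \<beta>" "\<not> \<beta> \<subseteq> \<alpha>"
  shows "\<alpha> \<inter> \<beta> \<subseteq> \<delta> \<or> \<delta> \<subseteq> \<alpha> \<inter> \<beta>" "\<alpha> \<union> \<beta> \<subseteq> \<delta> \<or> \<delta> \<subseteq> \<alpha> \<union> \<beta>"
  using partners_unique_order_ideals[OF assms(1-5)]
    partners_unique_order_ideals[OF assms(1,2,4,3,5)] assms(6,7) by blast+

section \<open>Complete intersections\<close>

definition hibi_binomial :: "'a set \<Rightarrow> 'a set \<Rightarrow> ('a set, 'k::comm_ring_1) mpoly" where
  "hibi_binomial \<alpha> \<beta> = mpoly_var \<alpha> * mpoly_var \<beta> - mpoly_var (\<alpha> \<inter> \<beta>) * mpoly_var (\<alpha> \<union> \<beta>)"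

lemma hibi_binomial_commute: "hibi_binomial \<alpha> \<beta> = hibi_binomial \<beta> \<alpha>"
  by (simp add: hibi_binomial_def ac_simps)

lemma hibi_relations_iff:
  "p \<in> hibi_relations P r \<longleftrightarrow> (\<exists>\<alpha> \<beta>. p = hibi_binomial \<alpha> \<beta> \<and>
     \<alpha> \<in> order_ideals P r \<and> \<beta> \<in> order_ideals P r \<and> \<not> \<alpha> \<subseteq> \<beta> \<and> \<not> \<beta> \<subseteq> \<alpha>)"
  by (simp add: hibi_relations_def hibi_binomial_def)

lemma hibi_relations_carrier: "hibi_relations P r \<subseteq> carrier (mpoly_ring (order_ideals P r))"
  by (auto simp: hibi_relations_iff hibi_binomial_def order_ideals_Int order_ideals_Un
      intro!: mpoly_carrier_intros)

lemma order_ge_hibi_binomial: "order_ge 2 (hibi_binomial \<alpha> \<beta>)"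
  unfolding hibi_binomial_def one_add_one[symmetric]
  by (intro order_ge_diff order_ge_mult order_ge_var)

lemma order_ge_hibi_ideal: "p \<in> hibi_ideal P r \<Longrightarrow> order_ge 2 p"
  unfolding hibi_ideal_def hibi_presentation_ring_def
  by (erule order_ge_genideal[OF hibi_relations_carrier, rotated])
     (auto simp: hibi_relations_iff order_ge_hibi_binomial)

lemma not_order_ge_3_hibi_binomial:
  assumes "\<not> \<alpha> \<subseteq> \<beta>" "\<not> \<beta> \<subseteq> \<alpha>"
  shows "\<not> order_ge 3 (hibi_binomial \<alpha> \<beta> :: ('a set, 'k::comm_ring_1) mpoly)"
proof -
  let ?m = "sgl \<alpha> 1 + sgl \<beta> (1::nat)" and ?n = "sgl (\<alpha> \<inter> \<beta>) 1 + sgl (\<alpha> \<union> \<beta>) (1::nat)"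
  \<comment> \<open>Incomparability makes \<open>\<alpha>\<close> differ from both meet and join, so
    the two monomials cannot cancel.\<close>
  have "lkp ?m \<alpha> \<noteq> lkp ?n \<alpha>"
    using assms by (auto simp: lookup_add lookup_single when_def)
  hence "?m \<noteq> ?n" by metis
  hence "lkp (hibi_binomial \<alpha> \<beta> :: ('a set, 'k) mpoly) ?m = 1"
    by (simp add: hibi_binomial_def mpoly_var_def mult_single lookup_minus lookup_single when_def)
  hence "?m \<in> kys (hibi_binomial \<alpha> \<beta> :: ('a set, 'k) mpoly)" by (simp add: in_keys_iff)
  thus ?thesis by (auto simp: order_ge_def mono_deg_add intro!: bexI[of _ ?m])
qed

section \<open>Necessity: two incomparable partners exclude a complete intersection\<close>

text \<open>
  The grid has rows \<open>A0 \<subset> A1 \<subset> A2\<close> and \<open>insert p A0 \<subset> insert p A1 \<subset> insert p A2\<close>; the linear syzygy is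
  the expansion of a \<open>3 \<times> 3\<close> determinant with the first row repeated.
\<close>

lemma complete_intersection_imp_partners_unique:
  assumes po: "partial_order_on P r"
    and ci: "hibi_ring_complete_intersection TYPE('k::field) P r"
  shows "partners_unique P r"
proof -
  have r: "r \<subseteq> P \<times> P" "\<And>x. x \<in> P \<Longrightarrow> (x, x) \<in> r" "trans r" "antisym r"
    using po by (auto simp: partial_order_on_def preorder_on_def refl_on_def)
  obtain fs :: "('a set, 'k) mpoly list"
    where fs: "regular_sequence (mpoly_ring (order_ideals P r)) fs"
      "hibi_ideal P r = Idl\<^bsub>mpoly_ring (order_ideals P r)\<^esub> (set fs)"
    using ci by (auto simp: hibi_ring_complete_intersection_def hibi_presentation_ring_def)
  have ord: "order_ge 2 h" if "h \<in> Idl\<^bsub>mpoly_ring (order_ideals P r)\<^esub> (set fs)" for h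
    using that order_ge_hibi_ideal[of h P r] unfolding fs(2) by blast
  \<comment> \<open>By antisymmetry two distinct partners of \<open>p\<close> can be named so that
    \<open>(y, x) \<notin> r\<close>; this puts \<open>y\<close> outside \<open>A1\<close>
    below.\<close>
  have False if p: "p \<in> P" "x \<in> P" "y \<in> P" "incomparable r p x" "incomparable r p y" "(y, x) \<notin> r"
    for p x y
  proof -
    \<comment> \<open>\<open>A0\<close> is the strict down-set of \<open>p\<close>, so that adding
      \<open>p\<close> gives an ideal again. Enlarging by the down-sets of \<open>x\<close> and
      \<open>y\<close> never includes \<open>p\<close>.\<close>
    define A0 where "A0 = {z. (z, p) \<in> r \<and> z \<noteq> p}"
    define A1 where "A1 = A0 \<union> {z. (z, x) \<in> r}"
    define A2 where "A2 = A1 \<union> {z. (z, y) \<in> r}"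
    note A_defs = A2_def A1_def A0_def
    have pn: "p \<notin> A0" "p \<notin> A1" "p \<notin> A2" using p by (auto simp: A_defs incomparable_def)
    have xy: "x \<notin> A0" "x \<in> A1" "y \<notin> A0" "y \<notin> A1" "y \<in> A2" "x \<noteq> p" "y \<noteq> p"
      using p r(2) by (auto simp: A_defs incomparable_def)
    have sub: "A0 \<subseteq> A1" "A1 \<subseteq> A2" "A0 \<subseteq> A2" by (auto simp: A_defs)
    have A0: "A0 \<in> order_ideals P r" "insert p A0 \<in> order_ideals P r"
      using r(1) p(1) transD[OF r(3)] antisymD[OF r(4)] unfolding order_ideals_def A0_def by blast+
    have down: "{z. (z, w) \<in> r} \<in> order_ideals P r" for w
      using r(1) transD[OF r(3)] unfolding order_ideals_def by blast
    have A1: "A1 \<in> order_ideals P r" "insert p A1 \<in> order_ideals P r"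
      using order_ideals_Un[OF A0(1) down] order_ideals_Un[OF A0(2) down]
      by (simp_all add: A1_def)
    have A2: "A2 \<in> order_ideals P r" "insert p A2 \<in> order_ideals P r"
      using order_ideals_Un[OF A1(1) down] order_ideals_Un[OF A1(2) down]
      by (simp_all add: A2_def)
    \<comment> \<open>The minor of the grid on columns \<open>A\<close> and \<open>B\<close>: its
      meet and join are \<open>A\<close> and \<open>insert p B\<close>.\<close>
    define M :: "'a set \<Rightarrow> 'a set \<Rightarrow> ('a set, 'k) mpoly"
      where "M A B = hibi_binomial B (insert p A)" for A B
    have M: "M A B = mpoly_var B * mpoly_var (insert p A) - mpoly_var A * mpoly_var (insert p B)"
      if "A \<subseteq> B" "p \<notin> B" for A B
    proof -
      have "B \<inter> insert p A = A" "B \<union> insert p A = insert p B" using that by auto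
      thus ?thesis by (simp add: M_def hibi_binomial_def)
    qed
    have MI: "M A B \<in> hibi_ideal P r"
      if "A \<subseteq> B" "p \<notin> B" "insert p A \<in> order_ideals P r" "B \<in> order_ideals P r" "w \<in> B - A" for A B w
      unfolding hibi_ideal_def hibi_presentation_ring_def M_def
      by (intro mpoly_genideal_self hibi_relations_carrier)
         (use that in \<open>auto simp: hibi_relations_iff\<close>)
    \<comment> \<open>The signed cofactors along the repeated row \<open>A0\<close>,
      \<open>A1\<close>, \<open>A2\<close>.\<close>
    define H where "H = (\<lambda>_. 0)(A0 := M A1 A2, A1 := - M A0 A2, A2 := M A0 A1)"
    have ne: "A0 \<noteq> A1" "A0 \<noteq> A2" "A1 \<noteq> A2" using xy by auto
    have H: "H A0 = M A1 A2" "H A1 = - M A0 A2" "H A2 = M A0 A1" using ne by (auto simp: H_def)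
    have "0 - M A0 A2 \<in> hibi_ideal P r"
      using MI[of A0 A2 y] unfolding hibi_ideal_def hibi_presentation_ring_def
      by (intro mpoly_genideal_diff mpoly_genideal_0 hibi_relations_carrier) (use sub pn xy A0 A2 in auto)
    hence "H v \<in> hibi_ideal P r" if "v \<in> {A0, A1, A2}" for v
      using that MI[of A1 A2 y] MI[of A0 A1 x] sub pn xy A0 A1 A2 by (auto simp: H)
    moreover have "(\<Sum>v\<in>{A0, A1, A2}. mpoly_var v * H v) = 0"
      using ne sub pn by (simp add: H M) (simp add: algebra_simps)
    ultimately have "order_ge 3 (H A0)"
      unfolding fs(2)
      by (intro regular_sequence_no_linear_syzygy[OF fs(1) ord, of "{A0, A1, A2}" H])
         (use A0 A1 A2 in auto)
    moreover have "\<not> order_ge 3 (M A1 A2)"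
      unfolding M_def by (rule not_order_ge_3_hibi_binomial) (use xy pn in auto)
    ultimately show False by (simp add: H)
  qed
  moreover have "(x, y) \<notin> r \<or> (y, x) \<notin> r" if "x \<noteq> y" for x y
    using that r(4) by (auto dest: antisymD)
  ultimately show ?thesis unfolding partners_unique_def by blast
qed

section \<open>Sufficiency: the Hibi relations as a regular sequence\<close>

lemma partners_unique_imp_complete_intersection:
  assumes fin: "finite P" and po: "partial_order_on P r" and pu: "partners_unique P r"
  shows "hibi_ring_complete_intersection TYPE('k::field) P r"
proof -
  let ?O = "order_ideals P r" and ?R = "hibi_relations P r :: ('a set, 'k) mpoly set"
  have tr: "trans r" using po by (simp add: partial_order_on_def preorder_on_def)
  have "finite ?O" using fin by (auto simp: order_ideals_def intro: finite_subset[of _ "Pow P"])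
  hence "finite ((\<lambda>(\<alpha>, \<beta>). hibi_binomial \<alpha> \<beta> :: ('a set, 'k) mpoly) ` (?O \<times> ?O))" by simp
  hence "finite ?R" by (rule finite_subset[rotated]) (auto simp: hibi_relations_iff)
  then obtain fs where fs: "set fs = ?R" "distinct fs" using finite_distinct_list by blast
  have I: "hibi_ideal P r = Idl\<^bsub>mpoly_ring ?O\<^esub> (set fs)"
    unfolding hibi_ideal_def hibi_presentation_ring_def fs(1) ..
  have "regular_sequence (mpoly_ring ?O) fs"
    unfolding regular_sequence_def
  proof (intro conjI allI impI ballI)
    show "set fs \<subseteq> carrier (mpoly_ring ?O)" unfolding fs(1) by (rule hibi_relations_carrier)
    \<comment> \<open>The ideal has no elements of order below 2, which excludes
      \<open>1\<close>.\<close>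
    have "1 \<notin> Idl\<^bsub>mpoly_ring ?O\<^esub> (set fs)"
      using order_ge_hibi_ideal[of "1 :: ('a set, 'k) mpoly" P r] unfolding I
      by (auto simp: order_ge_def mono_deg_def)
    moreover have "1 \<in> carrier (mpoly_ring ?O)" by (simp add: mpoly_carrier_iff)
    ultimately show "Idl\<^bsub>mpoly_ring ?O\<^esub> (set fs) \<noteq> carrier (mpoly_ring ?O)" by blast
  next
    fix i g
    assume i: "i < length fs" and g: "g \<in> carrier (mpoly_ring ?O)"
      and "fs ! i \<otimes>\<^bsub>mpoly_ring ?O\<^esub> g \<in> Idl\<^bsub>mpoly_ring ?O\<^esub> (set (take i fs))"
    hence fg: "fs ! i * g \<in> Idl\<^bsub>mpoly_ring ?O\<^esub> (set (take i fs))"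
      by (simp only: mpoly_ring_simps(2))
    have "fs ! i \<in> ?R" using nth_mem[OF i] fs(1) by simp
    then obtain \<alpha> \<beta> where f: "fs ! i = hibi_binomial \<alpha> \<beta>" and \<alpha>: "\<alpha> \<in> ?O" and \<beta>: "\<beta> \<in> ?O"
      and inc: "\<not> \<alpha> \<subseteq> \<beta>" "\<not> \<beta> \<subseteq> \<alpha>" by (auto simp: hibi_relations_iff)
    let ?u = "sgl \<alpha> 1 + sgl \<beta> (1::nat)"
    let ?q = "mpoly_var (\<alpha> \<inter> \<beta>) * mpoly_var (\<alpha> \<union> \<beta>) :: ('a set, 'k) mpoly"
    have u: "kys ?u = {\<alpha>, \<beta>}" by (auto simp: keys_add_nat)
    \<comment> \<open>Meets and joins of incomparable pairs are comparable to every ideal, whereas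
      \<open>\<alpha>\<close> and \<open>\<beta>\<close> are not.\<close>
    have avoids_Int_Un: "avoids {\<alpha>, \<beta>} (mpoly_var (\<alpha>' \<inter> \<beta>') * mpoly_var (\<alpha>' \<union> \<beta>') :: ('a set, 'k) mpoly)"
      if "\<alpha>' \<in> ?O" "\<beta>' \<in> ?O" "\<not> \<alpha>' \<subseteq> \<beta>'" "\<not> \<beta>' \<subseteq> \<alpha>'" for \<alpha>' \<beta>'
    proof -
      have "\<alpha>' \<inter> \<beta>' \<noteq> \<alpha>" "\<alpha>' \<union> \<beta>' \<noteq> \<alpha>"
        using partners_unique_Int_Un[OF tr pu that(1,2) \<beta> that(3,4)] inc by blast+
      moreover have "\<alpha>' \<inter> \<beta>' \<noteq> \<beta>" "\<alpha>' \<union> \<beta>' \<noteq> \<beta>"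
        using partners_unique_Int_Un[OF tr pu that(1,2) \<alpha> that(3,4)] inc by blast+
      ultimately show ?thesis by (intro avoids_mult avoids_var) auto
    qed
    show "g \<in> Idl\<^bsub>mpoly_ring ?O\<^esub> (set (take i fs))"
    proof (rule mono_minus_avoids_nonzerodivisor[where u = ?u and q = ?q])
      show "set (take i fs) \<subseteq> carrier (mpoly_ring ?O)"
        using set_take_subset[of i fs] hibi_relations_carrier unfolding fs(1) by (rule order_trans)
      show "?u \<noteq> 0" unfolding keys_eq_empty[symmetric] u by simp
      show "?q \<in> carrier (mpoly_ring ?O)"
        using \<alpha> \<beta> by (auto intro!: mpoly_carrier_intros simp: order_ideals_Int order_ideals_Un)
      show "avoids (kys ?u) ?q" unfolding u by (rule avoids_Int_Un[OF \<alpha> \<beta> inc])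
      show "(sgl ?u 1 - ?q) * g \<in> Idl\<^bsub>mpoly_ring ?O\<^esub> (set (take i fs))"
        using fg by (simp add: f hibi_binomial_def mpoly_var_def mult_single)
    next
      fix f' assume f': "f' \<in> set (take i fs)"
      have "f' \<in> ?R" using f' set_take_subset[of i fs] fs(1) by blast
      then obtain \<alpha>' \<beta>' where f'_eq: "f' = hibi_binomial \<alpha>' \<beta>'" and \<alpha>': "\<alpha>' \<in> ?O" and \<beta>': "\<beta>' \<in> ?O"
        and inc': "\<not> \<alpha>' \<subseteq> \<beta>'" "\<not> \<beta>' \<subseteq> \<alpha>'" by (auto simp: hibi_relations_iff)
      \<comment> \<open>Distinctness of the list separates \<open>f'\<close> from
        \<open>fs ! i\<close>; as the binomial is symmetric, this rules out both orderings of the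
        pair.\<close>
      have "f' \<noteq> fs ! i"
        using f' i fs(2) by (auto simp: in_set_conv_nth nth_eq_iff_index_eq)
      hence ne: "(\<alpha>', \<beta>') \<noteq> (\<alpha>, \<beta>)" "(\<alpha>', \<beta>') \<noteq> (\<beta>, \<alpha>)"
        using hibi_binomial_commute f f'_eq by auto
      note partner = partners_unique_order_ideals[OF tr pu]
      \<comment> \<open>A common member would determine its partner and make the two unordered pairs
        equal.\<close>
      have "\<alpha>' \<noteq> \<alpha>" "\<alpha>' \<noteq> \<beta>"
        using partner[OF \<alpha>' \<beta>' \<beta>] partner[OF \<alpha>' \<beta>' \<alpha>] inc inc' ne by auto
      moreover have "\<beta>' \<noteq> \<alpha>" "\<beta>' \<noteq> \<beta>"
        using partner[OF \<beta>' \<alpha>' \<beta>] partner[OF \<beta>' \<alpha>' \<alpha>] inc inc' ne by auto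
      ultimately show "avoids (kys ?u) f'"
        unfolding f'_eq hibi_binomial_def u
        by (intro avoids_diff avoids_Int_Un \<alpha>' \<beta>' inc') (auto intro!: avoids_mult avoids_var)
    qed (fact g)
  qed
  thus ?thesis
    unfolding hibi_ring_complete_intersection_def hibi_presentation_ring_def
    by (intro exI[of _ fs] conjI I)
qed

theorem theorem6p3:
  fixes P :: "'a set" and r :: "'a rel"
  assumes "finite P" and "partial_order_on P r"
  shows "hibi_ring_complete_intersection TYPE('k::field) P r \<longleftrightarrow>
    (linear_order_on P r \<or>
     (\<exists>n\<ge>1. poset_isomorphic (induced_subposet r (P - comparable_to_all P r))
              (antichain_pairs_sum n)))"
  using complete_intersection_imp_partners_unique[OF assms(2)]
    partners_unique_imp_complete_intersection[OF assms] partners_unique_iff[OF assms] by blast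

end
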